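(* Let $S^2$ be the two-dimensional Euclidean sphere. There is no non-Riemannian Finsler metric $F\colon TS^2\to\mathbb{R}$ admitting a compatible linear connection on $S^2$.
   Context: A Finsler metric on a connected smooth manifold $M$ is a continuous function $F\colon TM\to\mathbb{R}$ such that: $F$ is smooth on the complement of the zero section; $F(tv)=tF(v)$ for all $t>0$ and $v\in TM$; and, with $E=\frac12F^2$ and $y^1,\dots,y^n$ the induced fibre coordinates on $TM$, the Hessian $g_{ij}=\frac{\partial^2E}{\partial y^i\partial y^j}$ is positive definite at every nonzero tangent vector. $F$ is called Riemannian if there is a Riemannian metric $\gamma$ on $M$ with $F(v)^2=\gamma(v,v)$ for all $v\in TM$, and non-Riemannian otherwise. A linear connection $\nabla$ on (the tangent bundle of) $M$, possibly with torsion, is compatible with $F$ if the parallel transports with respect to $\nabla$ along curves in $M$ preserve the Finslerian length $F(v)$ of tangent vectors. *)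

theory Defs
  imports "HOL-Analysis.Analysis"
begin

section \<open>Smooth maps\<close>

primrec Ck_on :: "nat \<Rightarrow> 'a::euclidean_space set \<Rightarrow> ('a \<Rightarrow> 'b::euclidean_space) \<Rightarrow> bool" where
  "Ck_on 0 U f \<longleftrightarrow> continuous_on U f"
| "Ck_on (Suc k) U f \<longleftrightarrow>
     (\<forall>x\<in>U. f differentiable (at x)) \<and> (\<forall>v. Ck_on k U (\<lambda>x. frechet_derivative f (at x) v))"

text \<open>Smoothness on an arbitrary subset of a Euclidean space, in the usual sense of the
  differential topology of embedded submanifolds: local smooth extensions exist.
  Values of \<open>f\<close> outside \<open>A\<close> are irrelevant.\<close>

definition smooth_on :: "'a::euclidean_space set \<Rightarrow> ('a \<Rightarrow> 'b::euclidean_space) \<Rightarrow> bool" where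
  "smooth_on A f \<longleftrightarrow>
     (\<forall>x\<in>A. \<exists>U g. open U \<and> x \<in> U \<and> (\<forall>k. Ck_on k U g) \<and> (\<forall>y\<in>U \<inter> A. f y = g y))"


section \<open>The sphere and its tangent bundle\<close>

text \<open>The sphere is the unit sphere of three-space, its tangent plane at \<open>p\<close> is the linear
  subspace orthogonal to \<open>p\<close>, and its tangent bundle is the corresponding submanifold of the
  six-dimensional space of pairs.\<close>

definition S2 :: "(real^3) set" where
  "S2 = sphere 0 1"

definition tangent_space :: "real^3 \<Rightarrow> (real^3) set" where
  "tangent_space p = {v. p \<bullet> v = 0}"

definition TS2 :: "((real^3) \<times> (real^3)) set" where
  "TS2 = {(p, v). p \<in> S2 \<and> v \<in> tangent_space p}"

text \<open>Vector fields are total functions, of which only the values on \<open>S2\<close> matter.\<close>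

definition vector_field :: "(real^3 \<Rightarrow> real^3) \<Rightarrow> bool" where
  "vector_field X \<longleftrightarrow> smooth_on S2 X \<and> (\<forall>p\<in>S2. X p \<in> tangent_space p)"

text \<open>The derivative \<open>X(f)\<close> of a function along a vector field. The derivative of \<open>f\<close> at \<open>p\<close> within
  the sphere is not unique as a linear map on three-space, but its restriction to the tangent
  plane at \<open>p\<close>, the differential of \<open>f\<close>, is.\<close>

definition lie_deriv :: "(real^3 \<Rightarrow> real^3) \<Rightarrow> (real^3 \<Rightarrow> real) \<Rightarrow> real^3 \<Rightarrow> real" where
  "lie_deriv X f p = frechet_derivative f (at p within S2) (X p)"


section \<open>Finsler and Riemannian metrics\<close>

definition energy :: "((real^3) \<times> (real^3) \<Rightarrow> real) \<Rightarrow> (real^3) \<times> (real^3) \<Rightarrow> real" where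
  "energy F z = (F z)\<^sup>2 / 2"

text \<open>The Hessian of the energy along the fibre over \<open>p\<close>, at the tangent vector \<open>v\<close>, as a bilinear
  form. Its matrix with respect to the linear coordinates given by a basis of the
  tangent plane at \<open>p\<close> consists of the second partial derivatives of the energy in these
  fibre coordinates.\<close>

definition fibre_hessian ::
  "((real^3) \<times> (real^3) \<Rightarrow> real) \<Rightarrow> real^3 \<Rightarrow> real^3 \<Rightarrow> real^3 \<Rightarrow> real^3 \<Rightarrow> real" where
  "fibre_hessian F p v u w =
     deriv (\<lambda>s. deriv (\<lambda>t. energy F (p, v + s *\<^sub>R u + t *\<^sub>R w)) 0) 0"

definition finsler_metric :: "((real^3) \<times> (real^3) \<Rightarrow> real) \<Rightarrow> bool" where
  "finsler_metric F \<longleftrightarrow>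
     continuous_on TS2 F \<and>
     smooth_on {(p, v) \<in> TS2. v \<noteq> 0} F \<and>
     (\<forall>(p, v)\<in>TS2. \<forall>t>0. F (p, t *\<^sub>R v) = t * F (p, v)) \<and>
     (\<forall>(p, v)\<in>TS2. v \<noteq> 0 \<longrightarrow>
        (\<forall>w\<in>tangent_space p. w \<noteq> 0 \<longrightarrow> fibre_hessian F p v w w > 0))"

definition riemannian_metric :: "(real^3 \<Rightarrow> real^3 \<Rightarrow> real^3 \<Rightarrow> real) \<Rightarrow> bool" where
  "riemannian_metric \<gamma> \<longleftrightarrow>
     (\<forall>p\<in>S2. \<forall>u\<in>tangent_space p. \<forall>v\<in>tangent_space p. \<forall>w\<in>tangent_space p. \<forall>a b.
        \<gamma> p (a *\<^sub>R u + b *\<^sub>R v) w = a * \<gamma> p u w + b * \<gamma> p v w) \<and>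
     (\<forall>p\<in>S2. \<forall>u\<in>tangent_space p. \<forall>v\<in>tangent_space p. \<gamma> p u v = \<gamma> p v u) \<and>
     (\<forall>p\<in>S2. \<forall>v\<in>tangent_space p. v \<noteq> 0 \<longrightarrow> \<gamma> p v v > 0) \<and>
     (\<forall>X Y. vector_field X \<longrightarrow> vector_field Y \<longrightarrow> smooth_on S2 (\<lambda>p. \<gamma> p (X p) (Y p)))"

definition is_riemannian :: "((real^3) \<times> (real^3) \<Rightarrow> real) \<Rightarrow> bool" where
  "is_riemannian F \<longleftrightarrow>
     (\<exists>\<gamma>. riemannian_metric \<gamma> \<and> (\<forall>(p, v)\<in>TS2. (F (p, v))\<^sup>2 = \<gamma> p v v))"


section \<open>Linear connections and parallel transport\<close>

text \<open>A linear connection is a covariant derivative operator on vector fields; no condition is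
  imposed on the torsion. The axioms imply that \<open>nabla X Y\<close> depends on \<open>S2\<close> only on the values of \<open>X\<close>
  and \<open>Y\<close> on \<open>S2\<close> (functions vanishing on \<open>S2\<close> and arbitrary elsewhere are smooth there).\<close>

definition linear_connection ::
  "((real^3 \<Rightarrow> real^3) \<Rightarrow> (real^3 \<Rightarrow> real^3) \<Rightarrow> real^3 \<Rightarrow> real^3) \<Rightarrow> bool" where
  "linear_connection nabla \<longleftrightarrow>
     (\<forall>X Y. vector_field X \<longrightarrow> vector_field Y \<longrightarrow> vector_field (nabla X Y)) \<and>
     (\<forall>X X' Y f g. vector_field X \<longrightarrow> vector_field X' \<longrightarrow> vector_field Y \<longrightarrow>
        smooth_on S2 f \<longrightarrow> smooth_on S2 g \<longrightarrow>
        (\<forall>p\<in>S2. nabla (\<lambda>q. f q *\<^sub>R X q + g q *\<^sub>R X' q) Y p = f p *\<^sub>R nabla X Y p + g p *\<^sub>R nabla X' Y p)) \<and>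
     (\<forall>X Y Y' a b. vector_field X \<longrightarrow> vector_field Y \<longrightarrow> vector_field Y' \<longrightarrow>
        (\<forall>p\<in>S2. nabla X (\<lambda>q. a *\<^sub>R Y q + b *\<^sub>R Y' q) p = a *\<^sub>R nabla X Y p + b *\<^sub>R nabla X Y' p)) \<and>
     (\<forall>X Y f. vector_field X \<longrightarrow> vector_field Y \<longrightarrow> smooth_on S2 f \<longrightarrow>
        (\<forall>p\<in>S2. nabla X (\<lambda>q. f q *\<^sub>R Y q) p = lie_deriv X f p *\<^sub>R Y p + f p *\<^sub>R nabla X Y p))"

definition smooth_curve :: "real \<Rightarrow> real \<Rightarrow> (real \<Rightarrow> real^3) \<Rightarrow> bool" where
  "smooth_curve a b c \<longleftrightarrow> a < b \<and> smooth_on {a..b} c \<and> c ` {a..b} \<subseteq> S2"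

definition field_along :: "real \<Rightarrow> real \<Rightarrow> (real \<Rightarrow> real^3) \<Rightarrow> (real \<Rightarrow> real^3) \<Rightarrow> bool" where
  "field_along a b c V \<longleftrightarrow> smooth_on {a..b} V \<and> (\<forall>t\<in>{a..b}. V t \<in> tangent_space (c t))"

text \<open>\<open>D\<close> is the covariant derivative along \<open>c\<close> induced by \<open>nabla\<close>: the unique linear operator on the
  vector fields along \<open>c\<close> that satisfies the Leibniz rule and maps the restriction of a vector
  field \<open>Y\<close> to the covariant derivative of \<open>Y\<close> in the direction of the velocity of \<open>c\<close>. At time
  \<open>t\<close> the latter is computed with any vector field \<open>X\<close> whose value at \<open>c t\<close> is the velocity.\<close>

definition cov_deriv_along ::
  "((real^3 \<Rightarrow> real^3) \<Rightarrow> (real^3 \<Rightarrow> real^3) \<Rightarrow> real^3 \<Rightarrow> real^3) \<Rightarrow> real \<Rightarrow> real \<Rightarrow> (real \<Rightarrow> real^3) \<Rightarrow>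
   ((real \<Rightarrow> real^3) \<Rightarrow> real \<Rightarrow> real^3) \<Rightarrow> bool" where
  "cov_deriv_along nabla a b c D \<longleftrightarrow>
     (\<forall>V. field_along a b c V \<longrightarrow> field_along a b c (D V)) \<and>
     (\<forall>V W r s. field_along a b c V \<longrightarrow> field_along a b c W \<longrightarrow>
        (\<forall>t\<in>{a..b}. D (\<lambda>\<tau>. r *\<^sub>R V \<tau> + s *\<^sub>R W \<tau>) t = r *\<^sub>R D V t + s *\<^sub>R D W t)) \<and>
     (\<forall>V f. field_along a b c V \<longrightarrow> smooth_on {a..b} f \<longrightarrow>
        (\<forall>t\<in>{a..b}. D (\<lambda>\<tau>. f \<tau> *\<^sub>R V \<tau>) t =
           vector_derivative f (at t within {a..b}) *\<^sub>R V t + f t *\<^sub>R D V t)) \<and>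
     (\<forall>X Y t. vector_field X \<longrightarrow> vector_field Y \<longrightarrow> t \<in> {a..b} \<longrightarrow>
        X (c t) = vector_derivative c (at t within {a..b}) \<longrightarrow>
        D (\<lambda>\<tau>. Y (c \<tau>)) t = nabla X Y (c t))"

definition parallel_along ::
  "((real^3 \<Rightarrow> real^3) \<Rightarrow> (real^3 \<Rightarrow> real^3) \<Rightarrow> real^3 \<Rightarrow> real^3) \<Rightarrow> real \<Rightarrow> real \<Rightarrow> (real \<Rightarrow> real^3) \<Rightarrow>
   (real \<Rightarrow> real^3) \<Rightarrow> bool" where
  "parallel_along nabla a b c V \<longleftrightarrow>
     field_along a b c V \<and> (\<exists>D. cov_deriv_along nabla a b c D \<and> (\<forall>t\<in>{a..b}. D V t = 0))"

text \<open>The graph of the parallel transport along \<open>c\<close> from the tangent plane at \<open>c a\<close> to the one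
  at \<open>c b\<close>.\<close>

definition parallel_transport ::
  "((real^3 \<Rightarrow> real^3) \<Rightarrow> (real^3 \<Rightarrow> real^3) \<Rightarrow> real^3 \<Rightarrow> real^3) \<Rightarrow> real \<Rightarrow> real \<Rightarrow> (real \<Rightarrow> real^3) \<Rightarrow>
   real^3 \<Rightarrow> real^3 \<Rightarrow> bool" where
  "parallel_transport nabla a b c v w \<longleftrightarrow> (\<exists>V. parallel_along nabla a b c V \<and> V a = v \<and> V b = w)"

definition compatible ::
  "((real^3 \<Rightarrow> real^3) \<Rightarrow> (real^3 \<Rightarrow> real^3) \<Rightarrow> real^3 \<Rightarrow> real^3) \<Rightarrow>
   ((real^3) \<times> (real^3) \<Rightarrow> real) \<Rightarrow> bool" where
  "compatible nabla F \<longleftrightarrow>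
     (\<forall>a b c v w. smooth_curve a b c \<longrightarrow> parallel_transport nabla a b c v w \<longrightarrow>
        F (c b, w) = F (c a, v))"

end

theory Submission
  imports Defs
begin

text \<open>Transport the tangent plane at the north pole to the south pole along every meridian; this gives
  linear isomorphisms \<open>P \<phi>\<close>, depending continuously on the longitude \<open>\<phi>\<close>, that carry the norm \<open>F\<close> at one
  pole to the norm at the other. Transporting a fixed nonzero vector defines a nonvanishing tangent field
  on the sphere without the south pole. As in the proof of the hairy ball theorem, its index forces
  the loop \<open>\<phi> \<mapsto> P \<phi> v\<close> to wind twice around the origin, so this loop meets every ray. Hence the linear
  symmetries \<open>P \<phi> \<circ> (P 0)\<^sup>-\<^sup>1\<close> of the norm at the south pole act transitively on directions. They preserve
  the John ellipse of its unit ball, so the square of the norm is proportional to the John form.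
  Transport along the meridians then makes \<open>F\<^sup>2\<close> a quadratic form in every tangent plane.\<close>

section \<open>Calculus of smooth maps\<close>

text \<open>The number two comes from the frames. In the frame of meridian velocity and eastward
  direction, a fixed vector at the north pole has coordinate \<open>cis (- \<phi>)\<close>, since
  the frame rotates once with the longitude. At the south pole the meridians arrive with reversed
  velocity, so the frame has the opposite orientation in the horizontal plane, and the coordinate is
  \<open>- cnj (P \<phi> v * cis (- \<phi>))\<close>. If W is the winding number of the loop,
  equating the two gives -1 = 1 - W. Rays rather than lines must be met because \<open>F\<close> is
  homogeneous for positive factors only and may differ at v and -v. Two obstacles shape the rest.
  The sphere has no global tangent frame, so the transport is solved as a linear equation in all of
  three-space, where operators at different points can be compared and depend continuously on the
  longitude. And \<open>F\<close> is smooth only off the zero section, so the smoothness of the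
  polarized form needs a detour around zero vectors.\<close>

lemma Ck_on_imp_continuous_on: "Ck_on k U f \<Longrightarrow> continuous_on U f"
  by (cases k) (auto intro!: continuous_at_imp_continuous_on differentiable_imp_continuous_within)

lemma Ck_on_SucD: "Ck_on (Suc k) U f \<Longrightarrow> Ck_on k U f"
proof (induction k arbitrary: f)
  case 0
  then show ?case using Ck_on_imp_continuous_on[of "Suc 0" U f] by simp
next
  case (Suc k)
  then show ?case by (meson Ck_on.simps(2))
qed

lemma Ck_on_subset: "Ck_on k U f \<Longrightarrow> V \<subseteq> U \<Longrightarrow> Ck_on k V f"
  by (induction k arbitrary: f) (auto intro: continuous_on_subset)

text \<open>Derivatives are local, so the openness of \<open>U\<close> carries the derivative of
  \<open>f\<close> over to \<open>g\<close>.\<close>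

lemma Ck_on_cong:
  assumes "open U" "\<And>x. x \<in> U \<Longrightarrow> f x = g x" "Ck_on k U f"
  shows "Ck_on k U g"
  using assms(2,3)
proof (induction k arbitrary: f g)
  case 0
  then show ?case by (simp cong: continuous_on_cong)
next
  case (Suc k)
  have der: "(g has_derivative frechet_derivative f (at x)) (at x)" if "x \<in> U" for x
  proof -
    have "(f has_derivative frechet_derivative f (at x)) (at x)"
      using Suc.prems(2) that frechet_derivative_works by auto
    then show ?thesis
      by (rule has_derivative_transform_within_open[OF _ \<open>open U\<close> that]) (rule Suc.prems(1))
  qed
  then have eq: "frechet_derivative g (at x) = frechet_derivative f (at x)" if "x \<in> U" for x
    using that by (metis frechet_derivative_at)
  show ?case
    unfolding Ck_on.simps
  proof (intro conjI ballI allI)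
    show "g differentiable at x" if "x \<in> U" for x
      using der[OF that] by (rule differentiableI)
    show "Ck_on k U (\<lambda>x. frechet_derivative g (at x) v)" for v
      by (rule Suc.IH[where f="\<lambda>x. frechet_derivative f (at x) v"]) (use eq Suc.prems(2) in auto)
  qed
qed

text \<open>Derivatives at a point are unique, so an explicit \<open>f'\<close> can stand in for the
  choice made by \<open>frechet_derivative\<close>. Most closure properties below are proved through
  this form.\<close>

lemma Ck_on_SucI:
  assumes "open U" "\<And>x. x \<in> U \<Longrightarrow> (f has_derivative f' x) (at x)" "\<And>v. Ck_on k U (\<lambda>x. f' x v)"
  shows "Ck_on (Suc k) U f"
  unfolding Ck_on.simps
proof (intro conjI ballI allI)
  show "f differentiable at x" if "x \<in> U" for x
    using assms(2)[OF that] by (rule differentiableI)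
  show "Ck_on k U (\<lambda>x. frechet_derivative f (at x) v)" for v
    by (rule Ck_on_cong[OF assms(1) _ assms(3)[of v]]) (metis assms(2) frechet_derivative_at)
qed

lemma Ck_on_SucE:
  assumes "Ck_on (Suc k) U f" "x \<in> U"
  shows "(f has_derivative frechet_derivative f (at x)) (at x)"
  using assms frechet_derivative_works by auto

lemma Ck_on_const: "open U \<Longrightarrow> Ck_on k U (\<lambda>x. c)"
proof (induction k arbitrary: c)
  case (Suc k)
  show ?case
    by (rule Ck_on_SucI[where f'="\<lambda>x v. 0"]) (use Suc in \<open>auto intro: derivative_eq_intros\<close>)
qed auto

lemma Ck_on_bounded_linear:
  assumes "open U" "bounded_linear h"
  shows "Ck_on k U h"
proof (cases k)
  case 0
  then show ?thesis using assms by (simp add: linear_continuous_on)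
next
  case (Suc k')
  then show ?thesis
    using assms bounded_linear_imp_has_derivative
    by (auto simp del: Ck_on.simps intro!: Ck_on_SucI[where f'="\<lambda>x. h"] Ck_on_const)
qed

lemma Ck_on_add:
  assumes "open U" "Ck_on k U f" "Ck_on k U g"
  shows "Ck_on k U (\<lambda>x. f x + g x)"
  using assms(2,3)
proof (induction k arbitrary: f g)
  case (Suc k)
  have "Ck_on k U (\<lambda>x. frechet_derivative f (at x) v + frechet_derivative g (at x) v)" for v
    using Suc by auto
  then show ?case
    using Suc.prems
    by (intro Ck_on_SucI[where f'="\<lambda>x v. frechet_derivative f (at x) v + frechet_derivative g (at x) v"])
      (auto intro!: assms has_derivative_add Ck_on_SucE)
qed (auto intro: continuous_intros)

lemma Ck_on_sum:
  assumes "open U" "\<And>i. i \<in> I \<Longrightarrow> Ck_on k U (f i)"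
  shows "Ck_on k U (\<lambda>x. \<Sum>i\<in>I. f i x)"
  using assms(2)
  by (induction I rule: infinite_finite_induct) (auto intro: Ck_on_const Ck_on_add assms(1))

lemma Ck_on_bilinear:
  assumes "open U" "bounded_bilinear h" "Ck_on k U f" "Ck_on k U g"
  shows "Ck_on k U (\<lambda>x. h (f x) (g x))"
  using assms(3,4)
proof (induction k arbitrary: f g)
  case 0
  then show ?case using assms(2) by (simp add: bounded_bilinear.continuous_on)
next
  case (Suc k)
  have "Ck_on k U (\<lambda>x. h (f x) (frechet_derivative g (at x) v) + h (frechet_derivative f (at x) v) (g x))" for v
    using Suc Ck_on_SucD[OF Suc.prems(1)] Ck_on_SucD[OF Suc.prems(2)]
    by (intro Ck_on_add assms Suc.IH) auto
  then show ?case
    using Suc.prems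
    by (intro Ck_on_SucI[where f'="\<lambda>x v. h (f x) (frechet_derivative g (at x) v) + h (frechet_derivative f (at x) v) (g x)"])
      (auto intro!: assms bounded_bilinear.FDERIV Ck_on_SucE)
qed

text \<open>By the chain rule the derivative is \<open>g' (f x)\<close> applied to the vector
  \<open>f' x v\<close>, which itself varies with \<open>x\<close>. Expanding that vector in the
  basis separates the two: each summand is a product of a component of \<open>f' x v\<close> and a
  composition of \<open>f\<close> with a directional derivative of \<open>g\<close>, to which the
  induction hypothesis applies.\<close>

lemma Ck_on_compose:
  fixes f :: "'a::euclidean_space \<Rightarrow> 'b::euclidean_space" and g :: "'b \<Rightarrow> 'c::euclidean_space"
  assumes "open U" "open W" "f ` U \<subseteq> W" "Ck_on k U f" "Ck_on k W g"
  shows "Ck_on k U (\<lambda>x. g (f x))"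
  using assms(4,5)
proof (induction k arbitrary: g)
  case 0
  then show ?case using assms(3) by (auto intro: continuous_on_compose2)
next
  case (Suc k)
  let ?f' = "\<lambda>x. frechet_derivative f (at x)" and ?g' = "\<lambda>x. frechet_derivative g (at x)"
  have der: "((\<lambda>x. g (f x)) has_derivative (\<lambda>v. ?g' (f x) (?f' x v))) (at x)" if "x \<in> U" for x
  proof -
    have "(f has_derivative ?f' x) (at x)" "(g has_derivative ?g' (f x)) (at (f x))"
      using Suc.prems that assms(3) by (auto intro!: Ck_on_SucE)
    then show ?thesis
      by (rule has_derivative_compose)
  qed
  have rep: "(\<Sum>b\<in>Basis. (?f' x v \<bullet> b) *\<^sub>R ?g' (f x) b) = ?g' (f x) (?f' x v)" if "x \<in> U" for x v
  proof -
    have "linear (?g' (f x))"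
      using Suc.prems(2) that assms(3) linear_frechet_derivative by auto
    then have "(\<Sum>b\<in>Basis. (?f' x v \<bullet> b) *\<^sub>R ?g' (f x) b) = ?g' (f x) (\<Sum>b\<in>Basis. (?f' x v \<bullet> b) *\<^sub>R b)"
      by (simp add: linear_sum linear_scale)
    then show ?thesis by (simp add: euclidean_representation)
  qed
  have "Ck_on k U (\<lambda>x. \<Sum>b\<in>Basis. (?f' x v \<bullet> b) *\<^sub>R ?g' (f x) b)" for v
  proof (intro Ck_on_sum assms(1) Ck_on_bilinear[OF _ bounded_bilinear_scaleR])
    fix b :: 'b
    show "Ck_on k U (\<lambda>x. ?f' x v \<bullet> b)"
      using Suc.prems(1) by (intro Ck_on_bilinear[OF _ bounded_bilinear_inner] assms(1) Ck_on_const) auto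
    show "Ck_on k U (\<lambda>x. ?g' (f x) b)"
      using Suc.prems(2) Ck_on_SucD[OF Suc.prems(1)] by (intro Suc.IH) auto
  qed
  then have "Ck_on k U (\<lambda>x. ?g' (f x) (?f' x v))" for v
    by (rule Ck_on_cong[OF assms(1), rotated]) (simp add: rep)
  with der show ?case
    by (intro Ck_on_SucI[where f'="\<lambda>x v. ?g' (f x) (?f' x v)"] assms(1)) auto
qed

lemma Ck_on_local:
  assumes "\<And>x. x \<in> A \<Longrightarrow> \<exists>U. open U \<and> x \<in> U \<and> Ck_on k U f"
  shows "Ck_on k A f"
  using assms
proof (induction k arbitrary: f)
  case 0
  then show ?case
    unfolding Ck_on.simps
    by (metis continuous_at_imp_continuous_on continuous_on_eq_continuous_at)
next
  case (Suc k)
  show ?case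
    unfolding Ck_on.simps
  proof (intro conjI ballI allI)
    show "f differentiable at x" if "x \<in> A" for x
      using Suc.prems[OF that] by auto
    show "Ck_on k A (\<lambda>x. frechet_derivative f (at x) v)" for v
    proof (rule Suc.IH)
      show "\<exists>U. open U \<and> x \<in> U \<and> Ck_on k U (\<lambda>x. frechet_derivative f (at x) v)" if "x \<in> A" for x
        using Suc.prems[OF that] by auto
    qed
  qed
qed

text \<open>Each function is, up to sign, the derivative of the other, hence the joint
  induction.\<close>

lemma Ck_on_sin_cos: "Ck_on k UNIV (sin :: real \<Rightarrow> real) \<and> Ck_on k UNIV (cos :: real \<Rightarrow> real)"
proof (induction k)
  case 0
  then show ?case by (auto intro: continuous_intros)
next
  case (Suc k)
  have Ck_mult: "Ck_on k UNIV (\<lambda>x. h x * v)" if "h = sin \<or> h = cos" for h :: "real \<Rightarrow> real" and v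
    using Suc that by (intro Ck_on_bilinear[OF open_UNIV bounded_bilinear_mult] Ck_on_const) auto
  have "Ck_on (Suc k) UNIV (sin :: real \<Rightarrow> real)"
    by (rule Ck_on_SucI[where f'="\<lambda>x v. cos x * v"]) (auto intro!: derivative_eq_intros Ck_mult)
  moreover have "Ck_on k UNIV (\<lambda>x::real. - sin x * v)" for v
    using Ck_mult[of sin "-v"] by simp
  then have "Ck_on (Suc k) UNIV (cos :: real \<Rightarrow> real)"
    by (intro Ck_on_SucI[where f'="\<lambda>x v. - sin x * v"])
      (auto simp del: mult_minus_left intro!: derivative_eq_intros)
  ultimately show ?case by blast
qed

section \<open>Smooth maps on arbitrary subsets\<close>

lemma smooth_onE:
  assumes "smooth_on A f" "x \<in> A"
  obtains U g where "open U" "x \<in> U" "\<forall>k. Ck_on k U g" "\<forall>y\<in>U \<inter> A. f y = g y"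
  using bspec[OF iffD1[OF smooth_on_def assms(1)] assms(2)] by auto

lemma smooth_on_subset:
  assumes "smooth_on A f" "B \<subseteq> A"
  shows "smooth_on B f"
  unfolding smooth_on_def
proof
  fix x assume "x \<in> B"
  then have "x \<in> A" using assms(2) by blast
  obtain U h where "open U" "x \<in> U" "\<forall>k. Ck_on k U h" "\<forall>y\<in>U \<inter> A. f y = h y"
    using smooth_onE[OF assms(1) \<open>x \<in> A\<close>] by blast
  then show "\<exists>U h. open U \<and> x \<in> U \<and> (\<forall>k. Ck_on k U h) \<and> (\<forall>y\<in>U \<inter> B. f y = h y)"
    using assms(2) by (intro exI[of _ U] exI[of _ h]) auto
qed

lemma smooth_on_compose:
  fixes f :: "'a::euclidean_space \<Rightarrow> 'b::euclidean_space" and g :: "'b \<Rightarrow> 'c::euclidean_space"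
  assumes "smooth_on A f" "smooth_on B g" "f ` A \<subseteq> B"
  shows "smooth_on A (\<lambda>y. g (f y))"
  unfolding smooth_on_def
proof
  fix x assume "x \<in> A"
  then have "f x \<in> B" using assms(3) by auto
  obtain U f1 where U: "open U" "x \<in> U" "\<forall>k. Ck_on k U f1" "\<forall>y\<in>U \<inter> A. f y = f1 y"
    using smooth_onE[OF assms(1) \<open>x \<in> A\<close>] by blast
  obtain W g1 where W: "open W" "f x \<in> W" "\<forall>k. Ck_on k W g1" "\<forall>y\<in>W \<inter> B. g y = g1 y"
    using smooth_onE[OF assms(2) \<open>f x \<in> B\<close>] by blast
  let ?U = "U \<inter> f1 -` W"
  have "continuous_on U f1"
    using U(3) Ck_on_imp_continuous_on by blast
  then have "open ?U"
    using U(1) W(1) continuous_open_preimage by blast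
  moreover have "x \<in> ?U" using U(2,4) W(2) \<open>x \<in> A\<close> by auto
  moreover have "Ck_on k ?U (\<lambda>y. g1 (f1 y))" for k
    by (rule Ck_on_compose[OF \<open>open ?U\<close> W(1)]) (use W(3) in \<open>auto intro: Ck_on_subset[OF spec[OF U(3)]]\<close>)
  moreover have "g (f y) = g1 (f1 y)" if "y \<in> ?U \<inter> A" for y
    using that U(4) W(4) assms(3) by auto
  ultimately show "\<exists>U h. open U \<and> x \<in> U \<and> (\<forall>k. Ck_on k U h) \<and> (\<forall>y\<in>U \<inter> A. g (f y) = h y)"
    by (intro exI[of _ ?U] exI[of _ "\<lambda>y. g1 (f1 y)"]) auto
qed

lemma smooth_on_local:
  assumes "\<And>x. x \<in> A \<Longrightarrow> \<exists>W. open W \<and> x \<in> W \<and> smooth_on (A \<inter> W) f"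
  shows "smooth_on A f"
  unfolding smooth_on_def
proof
  fix x assume "x \<in> A"
  then obtain W where W: "open W" "x \<in> W" "smooth_on (A \<inter> W) f" using assms by blast
  then have "x \<in> A \<inter> W" using \<open>x \<in> A\<close> by auto
  obtain U g where U: "open U" "x \<in> U" "\<forall>k. Ck_on k U g" "\<forall>y\<in>U \<inter> (A \<inter> W). f y = g y"
    using smooth_onE[OF W(3) \<open>x \<in> A \<inter> W\<close>] by blast
  then show "\<exists>U g. open U \<and> x \<in> U \<and> (\<forall>k. Ck_on k U g) \<and> (\<forall>y\<in>U \<inter> A. f y = g y)"
    using W by (intro exI[of _ "U \<inter> W"] exI[of _ g]) (auto intro: Ck_on_subset)
qed

lemma Ck_on_imp_smooth_on:
  assumes "open U" "A \<subseteq> U" "\<And>k. Ck_on k U f"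
  shows "smooth_on A f"
  unfolding smooth_on_def
proof
  fix x assume "x \<in> A"
  then show "\<exists>U g. open U \<and> x \<in> U \<and> (\<forall>k. Ck_on k U g) \<and> (\<forall>y\<in>U \<inter> A. f y = g y)"
    using assms by (intro exI[of _ U] exI[of _ f]) auto
qed

lemma smooth_on_UNIV_imp_Ck_on:
  assumes "smooth_on UNIV f" shows "Ck_on k UNIV f"
proof (rule Ck_on_local)
  fix x
  obtain U g where U: "open U" "x \<in> U" "\<forall>k. Ck_on k U g" "\<forall>y\<in>U \<inter> UNIV. f y = g y"
    using smooth_onE[OF assms UNIV_I] by blast
  have "Ck_on k U f"
    by (rule Ck_on_cong[OF U(1) _ spec[OF U(3)]]) (use U(4) in auto)
  then show "\<exists>U. open U \<and> x \<in> U \<and> Ck_on k U f"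
    using U by blast
qed

lemma smooth_on_cong:
  assumes "\<And>x. x \<in> A \<Longrightarrow> f x = g x" "smooth_on A f"
  shows "smooth_on A g"
  unfolding smooth_on_def
proof
  fix x assume "x \<in> A"
  obtain U h where "open U" "x \<in> U" "\<forall>k. Ck_on k U h" "\<forall>y\<in>U \<inter> A. f y = h y"
    using smooth_onE[OF assms(2) \<open>x \<in> A\<close>] by blast
  then show "\<exists>U h. open U \<and> x \<in> U \<and> (\<forall>k. Ck_on k U h) \<and> (\<forall>y\<in>U \<inter> A. g y = h y)"
    using assms(1) by (intro exI[of _ U] exI[of _ h]) auto
qed

lemma smooth_on_const: "smooth_on A (\<lambda>x. c)"
  by (rule Ck_on_imp_smooth_on[of UNIV]) (auto intro: Ck_on_const)

lemma smooth_on_bounded_linear: "bounded_linear h \<Longrightarrow> smooth_on A h"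
  by (rule Ck_on_imp_smooth_on[of UNIV]) (auto intro: Ck_on_bounded_linear)

lemma smooth_on_bilinear:
  assumes "bounded_bilinear h" "smooth_on A f" "smooth_on A g"
  shows "smooth_on A (\<lambda>x. h (f x) (g x))"
  unfolding smooth_on_def
proof
  fix x assume "x \<in> A"
  obtain U f1 where U: "open U" "x \<in> U" "\<forall>k. Ck_on k U f1" "\<forall>y\<in>U \<inter> A. f y = f1 y"
    using smooth_onE[OF assms(2) \<open>x \<in> A\<close>] by blast
  obtain W g1 where W: "open W" "x \<in> W" "\<forall>k. Ck_on k W g1" "\<forall>y\<in>W \<inter> A. g y = g1 y"
    using smooth_onE[OF assms(3) \<open>x \<in> A\<close>] by blast
  have "Ck_on k (U \<inter> W) (\<lambda>y. h (f1 y) (g1 y))" for k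
    by (rule Ck_on_bilinear[OF _ assms(1)]) (use U W Ck_on_subset in blast)+
  then show "\<exists>U g'. open U \<and> x \<in> U \<and> (\<forall>k. Ck_on k U g') \<and> (\<forall>y\<in>U \<inter> A. h (f y) (g y) = g' y)"
    using U W by (intro exI[of _ "U \<inter> W"] exI[of _ "\<lambda>y. h (f1 y) (g1 y)"]) auto
qed

lemma smooth_on_add:
  assumes "smooth_on A f" "smooth_on A g"
  shows "smooth_on A (\<lambda>x. f x + g x)"
  unfolding smooth_on_def
proof
  fix x assume "x \<in> A"
  obtain U f1 where U: "open U" "x \<in> U" "\<forall>k. Ck_on k U f1" "\<forall>y\<in>U \<inter> A. f y = f1 y"
    using smooth_onE[OF assms(1) \<open>x \<in> A\<close>] by blast
  obtain W g1 where W: "open W" "x \<in> W" "\<forall>k. Ck_on k W g1" "\<forall>y\<in>W \<inter> A. g y = g1 y"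
    using smooth_onE[OF assms(2) \<open>x \<in> A\<close>] by blast
  have "Ck_on k (U \<inter> W) (\<lambda>y. f1 y + g1 y)" for k
    by (rule Ck_on_add) (use U W Ck_on_subset in blast)+
  then show "\<exists>U g'. open U \<and> x \<in> U \<and> (\<forall>k. Ck_on k U g') \<and> (\<forall>y\<in>U \<inter> A. f y + g y = g' y)"
    using U W by (intro exI[of _ "U \<inter> W"] exI[of _ "\<lambda>y. f1 y + g1 y"]) auto
qed

lemma smooth_on_Pair:
  assumes "smooth_on A f" "smooth_on A g"
  shows "smooth_on A (\<lambda>x. (f x, g x))"
proof -
  have "smooth_on A (\<lambda>x. (f x, 0) + (0, g x))"
    by (intro smooth_on_add smooth_on_compose[OF assms(1), where B=UNIV] smooth_on_compose[OF assms(2), where B=UNIV]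
        smooth_on_bounded_linear bounded_linear_Pair bounded_linear_ident bounded_linear_zero) auto
  then show ?thesis by simp
qed

lemmas smooth_on_scaleR = smooth_on_bilinear[OF bounded_bilinear_scaleR]
lemmas smooth_on_inner = smooth_on_bilinear[OF bounded_bilinear_inner]
lemmas smooth_on_mult = smooth_on_bilinear[OF bounded_bilinear_mult]
lemmas smooth_on_id = smooth_on_bounded_linear[OF bounded_linear_ident]

lemma smooth_on_linear_compose:
  "bounded_linear h \<Longrightarrow> smooth_on A f \<Longrightarrow> smooth_on A (\<lambda>x. h (f x))"
  by (rule smooth_on_compose[OF _ smooth_on_bounded_linear[of h UNIV]]) auto

lemma smooth_on_diff:
  assumes "smooth_on A f" "smooth_on A g"
  shows "smooth_on A (\<lambda>x. f x - g x)"
  using smooth_on_add[OF assms(1) smooth_on_linear_compose[OF bounded_linear_minus[OF bounded_linear_ident] assms(2)]]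
  by simp

lemma smooth_on_sum:
  assumes "\<And>i. i \<in> I \<Longrightarrow> smooth_on A (f i)"
  shows "smooth_on A (\<lambda>x. \<Sum>i\<in>I. f i x)"
  using assms
  by (induction I rule: infinite_finite_induct) (auto intro: smooth_on_const smooth_on_add)

lemma has_derivative_transform_open_Int:
  assumes "(g has_derivative g') (at x within A)" "open U" "x \<in> U" "x \<in> A" "\<forall>y\<in>U \<inter> A. f y = g y"
  shows "(f has_derivative g') (at x within A)"
proof (rule has_derivative_transform_eventually[OF assms(1) _ _ assms(4)])
  show "\<forall>\<^sub>F y in at x within A. g y = f y"
    unfolding eventually_at_topological using assms by (intro exI[of _ U]) auto
qed (use assms in auto)

text \<open>On a thin set such as the sphere the derivative within \<open>A\<close> is not unique.
  The derivative of a local extension shows differentiability, and this is enough for whichever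
  derivative \<open>frechet_derivative\<close> chooses.\<close>

lemma smooth_on_has_derivative:
  assumes "smooth_on A f" "x \<in> A"
  shows "(f has_derivative frechet_derivative f (at x within A)) (at x within A)"
proof -
  obtain U f1 where U: "open U" "x \<in> U" "\<forall>k. Ck_on k U f1" "\<forall>y\<in>U \<inter> A. f y = f1 y"
    using smooth_onE[OF assms] by blast
  have "(f1 has_derivative frechet_derivative f1 (at x)) (at x within A)"
    by (rule has_derivative_at_withinI[OF Ck_on_SucE[OF spec[OF U(3), of "Suc 0"] U(2)]])
  then have "(f has_derivative frechet_derivative f1 (at x)) (at x within A)"
    by (rule has_derivative_transform_open_Int) (use U assms(2) in auto)
  then show ?thesis
    using differentiableI frechet_derivative_works by blast
qed

lemma smooth_on_imp_continuous_on: "smooth_on A f \<Longrightarrow> continuous_on A f"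
  using smooth_on_has_derivative has_derivative_continuous continuous_on_eq_continuous_within by blast

lemma smooth_on_has_vector_derivative:
  assumes "smooth_on {a..b} f" "t \<in> {a..b}"
  shows "(f has_vector_derivative vector_derivative f (at t within {a..b})) (at t within {a..b})"
  using smooth_on_has_derivative[OF assms] differentiableI vector_derivative_works by blast

text \<open>On a nondegenerate interval the derivative is unique even at the end points, so it
  agrees with the derivative of any local smooth extension.\<close>

lemma smooth_on_vector_derivative:
  assumes "smooth_on {a..b} f" "a < b"
  shows "smooth_on {a..b} (\<lambda>t. vector_derivative f (at t within {a..b}))"
  unfolding smooth_on_def
proof
  fix x assume "x \<in> {a..b}"
  obtain U f1 where U: "open U" "x \<in> U" "\<forall>k. Ck_on k U f1" "\<forall>y\<in>U \<inter> {a..b}. f y = f1 y"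
    using smooth_onE[OF assms(1) \<open>x \<in> {a..b}\<close>] by blast
  have "vector_derivative f (at y within {a..b}) = frechet_derivative f1 (at y) 1" if "y \<in> U \<inter> {a..b}" for y
  proof -
    have "(f1 has_derivative frechet_derivative f1 (at y)) (at y within {a..b})"
      using that by (intro has_derivative_at_withinI[OF Ck_on_SucE[OF spec[OF U(3), of "Suc 0"]]]) auto
      then have "(f has_derivative frechet_derivative f1 (at y)) (at y within {a..b})"
      by (rule has_derivative_transform_open_Int) (use U that in auto)
    then have "(f has_vector_derivative frechet_derivative f1 (at y) 1) (at y within {a..b})"
      by (simp add: has_vector_derivative_def has_derivative_linear flip: linear_scale)
    then show ?thesis
      using that assms(2) by (intro vector_derivative_within_closed_interval) auto
  qed
  moreover have "Ck_on k U (\<lambda>y. frechet_derivative f1 (at y) 1)" for k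
    using spec[OF U(3), of "Suc k"] by simp
  ultimately show "\<exists>U g. open U \<and> x \<in> U \<and> (\<forall>k. Ck_on k U g) \<and>
      (\<forall>y\<in>U \<inter> {a..b}. vector_derivative f (at y within {a..b}) = g y)"
    using U(1,2) by blast
qed

section \<open>Linear differential equations with a parameter\<close>

text \<open>With an antiderivative \<open>H\<close> of \<open>h\<close>, the chain rule for
  \<open>H (t * s)\<close> in \<open>s\<close> turns the integral into \<open>H t - H 0\<close>,
  whatever the sign of \<open>t\<close>.\<close>

lemma has_vector_derivative_scaled_integral:
  fixes h :: "real \<Rightarrow> 'a::banach"
  assumes h: "continuous_on UNIV h"
  shows "((\<lambda>t. integral (cbox 0 1) (\<lambda>s. t *\<^sub>R h (t * s))) has_vector_derivative h t) (at t)"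
proof -
  define r where "r = \<bar>t\<bar> + 1"
  obtain H where H: "\<And>x. x \<in> {-r..r} \<Longrightarrow> (H has_vector_derivative h x) (at x within {-r..r})"
    using antiderivative_continuous[OF continuous_on_subset[OF h, of "{-r..r}"]] by auto
  have eq: "integral (cbox 0 1) (\<lambda>s. t' *\<^sub>R h (t' * s)) = H t' - H 0" if t': "t' \<in> {-r<..<r}" for t'
  proof -
    have "((\<lambda>s. H (t' * s)) has_vector_derivative t' *\<^sub>R h (t' * s)) (at s within {0..1})" if "s \<in> {0..1}" for s
    proof -
      have "\<bar>t' * u\<bar> \<le> r" if "u \<in> {0..1}" for u
      proof -
        have "\<bar>t' * u\<bar> \<le> \<bar>t'\<bar> * 1"
          unfolding abs_mult using that by (intro mult_left_mono) auto
        then show ?thesis using t' by auto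
      qed
      then have "(*) t' ` {0..1} \<subseteq> {-r..r}" by (force simp: abs_le_iff)
      then have "(H has_vector_derivative h (t' * s)) (at (t' * s) within (*) t' ` {0..1})"
        using that by (intro has_vector_derivative_within_subset[OF H]) (auto simp: image_subset_iff)
      moreover have "((*) t' has_vector_derivative t') (at s within {0..1})"
        by (auto intro!: derivative_eq_intros simp: has_real_derivative_iff_has_vector_derivative[symmetric])
      ultimately show ?thesis
        by (auto dest: vector_diff_chain_within simp: o_def)
    qed
    then have "((\<lambda>s. t' *\<^sub>R h (t' * s)) has_integral H (t' * 1) - H (t' * 0)) {0..1}"
      by (intro fundamental_theorem_of_calculus) auto
    from integral_unique[OF this] show ?thesis by simp
  qed
  have "t \<in> {-r<..<r}" by (auto simp: r_def)
  then have "(H has_vector_derivative h t) (at t)"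
    using H[of t] at_within_interior[of t "{-r..r}"] by auto
  then have "((\<lambda>t. H t - H 0) has_vector_derivative h t) (at t)"
    by (auto intro!: derivative_eq_intros)
  then show ?thesis
    by (rule has_vector_derivative_transform_within_open[OF _ open_greaterThanLessThan \<open>t \<in> {-r<..<r}\<close>])
      (use eq in simp)
qed

text \<open>The integral from \<open>0\<close> to \<open>t\<close> is rescaled to the unit interval: \<open>t\<close> may be negative, and
  joint continuity is that of an integral with a parameter.\<close>

primrec picard_term :: "('p \<times> real \<Rightarrow> 'a::banach \<Rightarrow>\<^sub>L 'a) \<Rightarrow> nat \<Rightarrow> 'p \<times> real \<Rightarrow> 'a \<Rightarrow>\<^sub>L 'a" where
  "picard_term A 0 = (\<lambda>_. id_blinfun)"
| "picard_term A (Suc n) = (\<lambda>z. integral (cbox 0 1)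
     (\<lambda>s. snd z *\<^sub>R (A (fst z, snd z * s) o\<^sub>L picard_term A n (fst z, snd z * s))))"

lemma continuous_on_picard_term:
  fixes A :: "'p::topological_space \<times> real \<Rightarrow> 'a::banach \<Rightarrow>\<^sub>L 'a"
  assumes A: "continuous_on (K \<times> UNIV) A"
  shows "continuous_on (K \<times> UNIV) (picard_term A n)"
proof (induction n)
  case (Suc n)
  have *: "continuous_on ((K \<times> UNIV) \<times> cbox 0 1) (\<lambda>x. h (fst (fst x), snd (fst x) * snd x))"
    if "continuous_on (K \<times> UNIV) h" for h :: "'p \<times> real \<Rightarrow> 'a \<Rightarrow>\<^sub>L 'a"
    by (rule continuous_on_compose2[OF that]) (auto intro!: continuous_intros)
  have "continuous_on ((K \<times> UNIV) \<times> cbox 0 1) (\<lambda>(z, s). snd z *\<^sub>R (A (fst z, snd z * s) o\<^sub>L picard_term A n (fst z, snd z * s)))"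
    unfolding case_prod_unfold
    by (intro continuous_on_scaleR bounded_bilinear.continuous_on[OF bounded_bilinear_blinfun_compose] * A Suc continuous_intros)
  then show ?case
    unfolding picard_term.simps by (rule integral_continuous_on_param)
qed auto

lemma continuous_on_picard_integrand:
  fixes A :: "'p::topological_space \<times> real \<Rightarrow> 'a::banach \<Rightarrow>\<^sub>L 'a"
  assumes "continuous_on (K \<times> UNIV) A" "continuous_on (K \<times> UNIV) V" "p \<in> K"
  shows "continuous_on S (\<lambda>t. A (p, t) o\<^sub>L V (p, t))"
  by (intro bounded_bilinear.continuous_on[OF bounded_bilinear_blinfun_compose]
      continuous_on_compose2[OF assms(1)] continuous_on_compose2[OF assms(2)] continuous_intros)
    (use assms(3) in auto)

text \<open>Integrating \<open>s ^ n\<close> over the unit interval contributes a factor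
  \<open>1 / (n + 1)\<close> at every step. These build up \<open>fact n\<close>, so the terms are
  dominated by an exponential series.\<close>

lemma norm_picard_term_le:
  fixes A :: "'p::topological_space \<times> real \<Rightarrow> 'a::banach \<Rightarrow>\<^sub>L 'a"
  assumes A: "continuous_on (K \<times> UNIV) A" and p: "p \<in> K"
    and M: "\<And>t. \<bar>t\<bar> \<le> r \<Longrightarrow> norm (A (p, t)) \<le> M" and "\<bar>t\<bar> \<le> r"
  shows "norm (picard_term A n (p, t)) \<le> (M * \<bar>t\<bar>) ^ n / fact n"
  using \<open>\<bar>t\<bar> \<le> r\<close>
proof (induction n arbitrary: t)
  case 0
  then show ?case by (simp add: norm_blinfun_id_le)
next
  case (Suc n)
  let ?g = "\<lambda>s. \<bar>t\<bar> * (M * ((M * \<bar>t\<bar> * s) ^ n / fact n))"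
  have "0 \<le> M" using order_trans[OF norm_ge_zero M[OF Suc.prems]] .
  have "(?g has_integral (M * \<bar>t\<bar>) ^ Suc n * 1 ^ Suc n / fact (Suc n) - (M * \<bar>t\<bar>) ^ Suc n * 0 ^ Suc n / fact (Suc n)) {0..1}"
  proof (intro fundamental_theorem_of_calculus)
    fix s :: real assume "s \<in> {0..1}"
    have "((\<lambda>s. (M * \<bar>t\<bar>) ^ Suc n * s ^ Suc n / fact (Suc n)) has_real_derivative
        (M * \<bar>t\<bar>) ^ Suc n * (real (Suc n) * s ^ n) / fact (Suc n)) (at s within {0..1})"
      by (intro DERIV_cdivide DERIV_cmult) (use DERIV_pow[of "Suc n" s "{0..1}"] in simp)
    also have "(M * \<bar>t\<bar>) ^ Suc n * (real (Suc n) * s ^ n) / fact (Suc n) = ?g s"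
      by (simp add: field_simps power_mult_distrib del: of_nat_Suc)
    finally show "((\<lambda>s. (M * \<bar>t\<bar>) ^ Suc n * s ^ Suc n / fact (Suc n)) has_vector_derivative ?g s) (at s within {0..1})"
      by (simp add: has_real_derivative_iff_has_vector_derivative)
  qed auto
  then have int: "(?g has_integral (M * \<bar>t\<bar>) ^ Suc n / fact (Suc n)) (cbox 0 1)"
    by simp
  have "norm (picard_term A (Suc n) (p, t)) \<le> integral (cbox 0 1) ?g"
    unfolding picard_term.simps fst_conv snd_conv
  proof (rule integral_norm_bound_integral)
    have "continuous_on (cbox 0 1) (\<lambda>s. A (p, t * s) o\<^sub>L picard_term A n (p, t * s))"
      by (rule continuous_on_compose2[OF continuous_on_picard_integrand[OF A continuous_on_picard_term[OF A] p, of UNIV n]])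
        (auto intro: continuous_intros)
    then show "(\<lambda>s. t *\<^sub>R (A (p, t * s) o\<^sub>L picard_term A n (p, t * s))) integrable_on cbox 0 1"
      by (intro integrable_continuous continuous_on_scaleR continuous_on_const)
    show "?g integrable_on cbox 0 1" using int by blast
    fix s :: real assume s: "s \<in> cbox 0 1"
    then have "\<bar>t * s\<bar> \<le> \<bar>t\<bar> * 1"
      unfolding abs_mult by (intro mult_left_mono) auto
    then have ts: "\<bar>t * s\<bar> \<le> r" using Suc.prems by simp
    have "norm (A (p, t * s) o\<^sub>L picard_term A n (p, t * s)) \<le> norm (A (p, t * s)) * norm (picard_term A n (p, t * s))"
      by (rule norm_blinfun_compose)
    also have "\<dots> \<le> M * ((M * \<bar>t * s\<bar>) ^ n / fact n)"
      using M[OF ts] Suc.IH[OF ts] \<open>0 \<le> M\<close> by (intro mult_mono) auto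
    finally have "norm (A (p, t * s) o\<^sub>L picard_term A n (p, t * s)) \<le> M * ((M * \<bar>t * s\<bar>) ^ n / fact n)" .
    from mult_left_mono[OF this abs_ge_zero[of t]]
    show "norm (t *\<^sub>R (A (p, t * s) o\<^sub>L picard_term A n (p, t * s))) \<le> ?g s"
      using s by (simp add: abs_mult mult.assoc)
  qed
  also have "\<dots> = (M * \<bar>t\<bar>) ^ Suc n / fact (Suc n)"
    using int by (rule integral_unique)
  finally show ?case .
qed

text \<open>The solution is the sum of the Picard terms. Compactness of \<open>K\<close> bounds
  \<open>A\<close> uniformly in the parameter on every bounded time interval; the resulting uniform
  convergence gives joint continuity and permits termwise integration, which is the integral
  equation.\<close>

lemma linear_ode_with_parameter:
  fixes A :: "'p::t2_space \<times> real \<Rightarrow> 'a::banach \<Rightarrow>\<^sub>L 'a"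
  assumes "compact K" and A: "continuous_on (K \<times> UNIV) A"
  obtains V where "continuous_on (K \<times> UNIV) V" "\<And>p. p \<in> K \<Longrightarrow> V (p, 0) = id_blinfun"
    "\<And>p t. p \<in> K \<Longrightarrow> ((\<lambda>t. V (p, t)) has_vector_derivative A (p, t) o\<^sub>L V (p, t)) (at t)"
proof -
  let ?u = "picard_term A"
  define V where "V = (\<lambda>z. \<Sum>n. ?u n z)"
  have bound: "\<exists>M\<ge>0. \<forall>p\<in>K. \<forall>t\<in>{-r..r}. norm (A (p, t)) \<le> M" for r
  proof -
    have "compact (A ` (K \<times> {-r..r}))"
      by (intro compact_continuous_image continuous_on_subset[OF A] compact_Times assms) auto
    then obtain M where "\<forall>x\<in>A ` (K \<times> {-r..r}). norm x \<le> M"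
      using compact_imp_bounded bounded_iff by blast
    then show ?thesis
      by (intro exI[of _ "max M 0"]) force
  qed
  have term_bound: "\<exists>M\<ge>0. \<forall>p\<in>K. \<forall>t\<in>{-r..r}. norm (A (p, t)) \<le> M \<and>
      (\<forall>n. norm (?u n (p, t)) \<le> (M * r) ^ n / fact n)" for r
  proof -
    obtain M where M: "M \<ge> 0" "\<forall>p\<in>K. \<forall>t\<in>{-r..r}. norm (A (p, t)) \<le> M"
      using bound by blast
    have "norm (?u n (p, t)) \<le> (M * r) ^ n / fact n" if "p \<in> K" "t \<in> {-r..r}" for n p t
    proof -
      have t: "\<bar>t\<bar> \<le> r" using that by auto
      have "norm (?u n (p, t)) \<le> (M * \<bar>t\<bar>) ^ n / fact n"
        by (rule norm_picard_term_le[OF A that(1) _ t]) (use M that(1) in \<open>auto simp: abs_le_iff\<close>)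
      also have "\<dots> \<le> (M * r) ^ n / fact n"
        using t M(1) by (intro divide_right_mono power_mono mult_left_mono) auto
      finally show ?thesis .
    qed
    with M show ?thesis by blast
  qed
  have summ: "summable (\<lambda>n. c ^ n / fact n)" for c :: real
    using summable_exp[of c] by (simp add: field_simps)
  have unif: "uniform_limit (K \<times> {-r..r}) (\<lambda>n z. \<Sum>i<n. ?u i z) V sequentially" for r
  proof -
    obtain M where "\<forall>p\<in>K. \<forall>t\<in>{-r..r}. \<forall>n. norm (?u n (p, t)) \<le> (M * r) ^ n / fact n"
      using term_bound by blast
    then show ?thesis
      unfolding V_def by (intro Weierstrass_m_test[OF _ summ]) auto
  qed
  have summable_u: "summable (\<lambda>n. ?u n (p, t))" if "p \<in> K" for p t
  proof -
    obtain M where "\<forall>p\<in>K. \<forall>s\<in>{-\<bar>t\<bar>..\<bar>t\<bar>}. \<forall>n. norm (?u n (p, s)) \<le> (M * \<bar>t\<bar>) ^ n / fact n"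
      using term_bound by blast
    then have "norm (?u n (p, t)) \<le> (M * \<bar>t\<bar>) ^ n / fact n" for n
      using that by (metis atLeastAtMost_iff abs_ge_self abs_ge_minus_self minus_le_iff)
    then show ?thesis
      by (intro summable_comparison_test'[OF summ[of "M * \<bar>t\<bar>"], of 0])
  qed
  \<comment> \<open>Convergence is uniform on bounded strips only. The margin 1 in \<open>r\<close>
    makes the strip a neighbourhood of \<open>z\<close>, so continuity there suffices.\<close>
  have contV: "continuous_on (K \<times> UNIV) V"
    unfolding continuous_on_eq_continuous_within
  proof
    fix z assume z: "z \<in> K \<times> (UNIV :: real set)"
    define r where "r = \<bar>snd z\<bar> + 1"
    have "continuous_on (K \<times> {-r..r}) V"
      by (rule uniform_limit_theorem[OF _ unif])
        (auto intro!: always_eventually continuous_on_sum continuous_on_subset[OF continuous_on_picard_term[OF A]])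
    moreover have "z \<in> K \<times> {-r..r}" using z by (auto simp: r_def)
    ultimately have "continuous (at z within (K \<times> {-r..r})) V"
      using continuous_on_eq_continuous_within by blast
    moreover have "at z within (K \<times> {-r..r}) = at z within (K \<times> UNIV)"
      by (rule at_within_nhd[of z "UNIV \<times> {-r<..<r}"]) (auto simp: r_def open_Times mem_Times_iff)
    ultimately show "continuous (at z within (K \<times> UNIV)) V" by simp
  qed
  have fixpoint: "V (p, t) = id_blinfun + integral (cbox 0 1) (\<lambda>s. t *\<^sub>R (A (p, t * s) o\<^sub>L V (p, t * s)))"
    if p: "p \<in> K" for p t
  proof -
    let ?w = "\<lambda>n s. t *\<^sub>R (A (p, t * s) o\<^sub>L ?u n (p, t * s))"
    obtain M where M: "M \<ge> 0" "\<forall>p\<in>K. \<forall>s\<in>{-\<bar>t\<bar>..\<bar>t\<bar>}. norm (A (p, s)) \<le> M \<and> (\<forall>n. norm (?u n (p, s)) \<le> (M * \<bar>t\<bar>) ^ n / fact n)"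
      using term_bound[of "\<bar>t\<bar>"] by blast
    have wbound: "norm (?w n s) \<le> \<bar>t\<bar> * M * ((M * \<bar>t\<bar>) ^ n / fact n)" if s: "s \<in> cbox 0 1" for n s
    proof -
      have "\<bar>t * s\<bar> \<le> \<bar>t\<bar> * 1"
        unfolding abs_mult using s by (intro mult_left_mono) auto
      then have ts: "t * s \<in> {-\<bar>t\<bar>..\<bar>t\<bar>}" by auto
      have "norm (A (p, t * s) o\<^sub>L ?u n (p, t * s)) \<le> norm (A (p, t * s)) * norm (?u n (p, t * s))"
        by (rule norm_blinfun_compose)
      also have "\<dots> \<le> M * ((M * \<bar>t\<bar>) ^ n / fact n)"
        using M ts p by (intro mult_mono) auto
      finally have "norm (A (p, t * s) o\<^sub>L ?u n (p, t * s)) \<le> M * ((M * \<bar>t\<bar>) ^ n / fact n)" .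
      from mult_left_mono[OF this abs_ge_zero[of t]] show ?thesis
        by (simp add: mult.assoc)
    qed
    have "uniform_limit (cbox 0 1) (\<lambda>n s. \<Sum>i<n. ?w i s) (\<lambda>s. \<Sum>i. ?w i s) sequentially"
      by (intro Weierstrass_m_test[where M="\<lambda>n. \<bar>t\<bar> * M * ((M * \<bar>t\<bar>) ^ n / fact n)"] wbound summable_mult summ)
    moreover have "(\<Sum>i. ?w i s) = t *\<^sub>R (A (p, t * s) o\<^sub>L V (p, t * s))" for s
    proof -
      have "bounded_linear (\<lambda>X. t *\<^sub>R (A (p, t * s) o\<^sub>L X))"
        by (intro bounded_linear_intros bounded_bilinear.bounded_linear_right[OF bounded_bilinear_blinfun_compose])
      from bounded_linear.suminf[OF this summable_u[OF p]] show ?thesis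
        by (simp add: V_def)
    qed
    ultimately have lim: "uniform_limit (cbox 0 1) (\<lambda>n s. \<Sum>i<n. ?w i s) (\<lambda>s. t *\<^sub>R (A (p, t * s) o\<^sub>L V (p, t * s))) sequentially"
      by simp
    have wcont: "continuous_on (cbox 0 1) (?w n)" for n
    proof -
      have "continuous_on (cbox 0 1) (\<lambda>s. A (p, t * s) o\<^sub>L ?u n (p, t * s))"
        by (rule continuous_on_compose2[OF continuous_on_picard_integrand[OF A continuous_on_picard_term[OF A] p, of UNIV n]])
          (auto intro: continuous_intros)
      then show ?thesis by (intro continuous_on_scaleR continuous_on_const)
    qed
    have sumcont: "continuous_on (cbox 0 1) (\<lambda>s. \<Sum>i<n. ?w i s)" for n
      by (intro continuous_on_sum wcont)
    obtain I J where IJ: "\<forall>n. ((\<lambda>s. \<Sum>i<n. ?w i s) has_integral I n) (cbox 0 1)"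
        "((\<lambda>s. t *\<^sub>R (A (p, t * s) o\<^sub>L V (p, t * s))) has_integral J) (cbox 0 1)" "I \<longlonglongrightarrow> J"
      using uniform_limit_integral_cbox[OF lim sumcont trivial_limit_sequentially] by blast
    have "I = (\<lambda>n. \<Sum>i<n. ?u (Suc i) (p, t))"
    proof
      fix n
      have "I n = integral (cbox 0 1) (\<lambda>s. \<Sum>i<n. ?w i s)"
        using integral_unique[OF spec[OF IJ(1), of n]] by simp
      also have "\<dots> = (\<Sum>i<n. ?u (Suc i) (p, t))"
        unfolding picard_term.simps fst_conv snd_conv
        by (rule integral_sum) (simp_all only: finite_lessThan integrable_continuous[OF wcont])
      finally show "I n = (\<Sum>i<n. ?u (Suc i) (p, t))" .
    qed
    \<comment> \<open>Integration shifts the index by one, so the limit lacks the term of index 0,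
      the initial value \<open>id_blinfun\<close>.\<close>
    moreover have "(\<lambda>i. ?u (Suc i) (p, t)) sums (V (p, t) - ?u 0 (p, t))"
      by (subst sums_Suc_iff) (simp only: diff_add_cancel V_def summable_sums[OF summable_u[OF p]])
    ultimately have "J = V (p, t) - id_blinfun"
      using IJ(3) LIMSEQ_unique unfolding sums_def by (metis picard_term.simps(1))
    then show ?thesis
      using integral_unique[OF IJ(2)] by simp
  qed
  show ?thesis
  proof
    show "continuous_on (K \<times> UNIV) V" by (rule contV)
    show "V (p, 0) = id_blinfun" if "p \<in> K" for p
      using fixpoint[OF that, of 0] by simp
    show "((\<lambda>t. V (p, t)) has_vector_derivative A (p, t) o\<^sub>L V (p, t)) (at t)" if "p \<in> K" for p t
    proof -
      have "((\<lambda>t. id_blinfun + integral (cbox 0 1) (\<lambda>s. t *\<^sub>R (A (p, t * s) o\<^sub>L V (p, t * s))))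
          has_vector_derivative 0 + (A (p, t) o\<^sub>L V (p, t))) (at t)"
        by (intro has_vector_derivative_add has_vector_derivative_const has_vector_derivative_scaled_integral
            continuous_on_picard_integrand[OF A contV that])
      then show ?thesis
        by (simp only: fixpoint[OF that, symmetric] add_0)
    qed
  qed
qed

section \<open>The John ellipse in the plane\<close>

text \<open>The triple (a, b, c) encodes the symmetric matrix with rows (a, b) and (b, c). Forms
  thus live in a Euclidean space, where a maximal determinant can be found by compactness.\<close>

definition qform :: "real \<times> real \<times> real \<Rightarrow> complex \<Rightarrow> real" where
  "qform q z = fst q * (Re z)\<^sup>2 + 2 * fst (snd q) * Re z * Im z + snd (snd q) * (Im z)\<^sup>2"

definition qdet :: "real \<times> real \<times> real \<Rightarrow> real" where
  "qdet q = fst q * snd (snd q) - (fst (snd q))\<^sup>2"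

definition cdet :: "(complex \<Rightarrow> complex) \<Rightarrow> real" where
  "cdet A = Re (A 1) * Im (A \<i>) - Im (A 1) * Re (A \<i>)"

text \<open>The matrix product of the transpose of \<open>A\<close>, the matrix of \<open>q\<close>
  and \<open>A\<close>.\<close>

definition qpull :: "(complex \<Rightarrow> complex) \<Rightarrow> real \<times> real \<times> real \<Rightarrow> real \<times> real \<times> real" where
  "qpull A q =
     (qform q (A 1),
      fst q * Re (A 1) * Re (A \<i>) + fst (snd q) * (Re (A 1) * Im (A \<i>) + Im (A 1) * Re (A \<i>))
        + snd (snd q) * Im (A 1) * Im (A \<i>),
      qform q (A \<i>))"

lemma linear_complex_expand:
  assumes "linear A"
  shows "A z = Re z *\<^sub>R A 1 + Im z *\<^sub>R A \<i>"
proof -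
  have "A z = A (Re z *\<^sub>R 1 + Im z *\<^sub>R \<i>)"
    by (rule arg_cong[of _ _ A]) (simp add: complex_eq_iff)
  then show ?thesis
    by (simp add: linear_add[OF assms] linear_scale[OF assms])
qed

lemma qform_qpull:
  assumes "linear A"
  shows "qform (qpull A q) z = qform q (A z)"
  unfolding linear_complex_expand[OF assms, of z]
  by (simp add: qform_def qpull_def power2_eq_square algebra_simps)

lemma qdet_qpull: "qdet (qpull A q) = qdet q * (cdet A)\<^sup>2"
  by (simp add: qform_def qpull_def qdet_def cdet_def power2_eq_square algebra_simps)

lemma cdet_inverse:
  assumes "linear A" "\<And>z. A (B z) = z"
  shows "cdet A * cdet B = 1"
proof -
  have "Re (B 1) * Re (A 1) + Im (B 1) * Re (A \<i>) = 1" "Re (B 1) * Im (A 1) + Im (B 1) * Im (A \<i>) = 0"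
    "Re (B \<i>) * Re (A 1) + Im (B \<i>) * Re (A \<i>) = 0" "Re (B \<i>) * Im (A 1) + Im (B \<i>) * Im (A \<i>) = 1"
    using assms(2)[of 1] assms(2)[of \<i>] linear_complex_expand[OF assms(1), of "B 1"]
      linear_complex_expand[OF assms(1), of "B \<i>"] by (simp_all add: complex_eq_iff)
  moreover have "cdet A * cdet B =
      (Re (B 1) * Re (A 1) + Im (B 1) * Re (A \<i>)) * (Re (B \<i>) * Im (A 1) + Im (B \<i>) * Im (A \<i>)) -
      (Re (B 1) * Im (A 1) + Im (B 1) * Im (A \<i>)) * (Re (B \<i>) * Re (A 1) + Im (B \<i>) * Re (A \<i>))"
    by (simp add: cdet_def algebra_simps)
  ultimately show ?thesis by simp
qed

text \<open>Strict concavity behind the uniqueness of the John ellipse. Eliminating \<open>c\<close>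
  and \<open>c'\<close> through the common determinant turns the gain into a positive combination of
  the squares of \<open>a * b' - a' * b\<close> and \<open>a - a'\<close>, which vanish together
  only for equal forms.\<close>

lemma qdet_midpoint:
  assumes "fst q > 0" "fst q' > 0" "qdet q = d" "qdet q' = d" "d > 0" "q \<noteq> q'"
  shows "qdet ((1 / 2) *\<^sub>R (q + q')) > d"
proof -
  obtain a b c a' b' c' where q: "q = (a, b, c)" "q' = (a', b', c')" by (cases q, cases q') auto
  have a: "a > 0" "a' > 0" using assms q by auto
  have c: "c = (d + b\<^sup>2) / a" "c' = (d + b'\<^sup>2) / a'"
    using assms(3,4) a q by (auto simp: qdet_def field_simps)
  have "a * c' + a' * c - 2 * b * b' - 2 * d = ((a * b' - a' * b)\<^sup>2 + d * (a - a')\<^sup>2) / (a * a')"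
    using a by (simp add: c field_simps power2_eq_square)
  moreover have "(a * b' - a' * b)\<^sup>2 + d * (a - a')\<^sup>2 > 0"
  proof (cases "a = a'")
    case True
    then have "b \<noteq> b'" using assms(6) c q by auto
    with True a assms(5) show ?thesis by (simp flip: right_diff_distrib)
  next
    case False
    then show ?thesis using assms(5) by (simp add: add_nonneg_pos)
  qed
  ultimately have *: "a * c' + a' * c - 2 * b * b' - 2 * d > 0"
    using a by simp
  have "4 * qdet ((1 / 2) *\<^sub>R (q + q')) = a * c - b\<^sup>2 + (a' * c' - b'\<^sup>2) + (a * c' + a' * c - 2 * b * b')"
    by (simp add: q qdet_def power2_eq_square field_simps)
  then show ?thesis using * assms(3,4) by (simp add: q qdet_def)
qed

lemma qform_scaleR_add: "qform (s *\<^sub>R q + t *\<^sub>R q') z = s * qform q z + t * qform q' z"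
  by (simp add: qform_def algebra_simps)

lemma qform_scaleR: "qform q (r *\<^sub>R z) = r\<^sup>2 * qform q z"
  by (simp add: qform_def power2_eq_square algebra_simps)

text \<open>The form of maximal determinant below \<open>f\<close> is the John ellipse of \<open>f\<close>; being unique, it is
  invariant under the linear symmetries of \<open>f\<close>.\<close>

lemma john_form:
  fixes f :: "complex \<Rightarrow> real"
  assumes cont: "continuous_on UNIV f" and pos: "\<And>z. z \<noteq> 0 \<Longrightarrow> f z > 0"
    and hom: "\<And>r z. r > 0 \<Longrightarrow> f (r *\<^sub>R z) = r\<^sup>2 * f z"
  obtains q where "\<And>z. z \<noteq> 0 \<Longrightarrow> qform q z > 0"
    "\<And>A. linear A \<Longrightarrow> f \<circ> A = f \<Longrightarrow> qform q \<circ> A = qform q"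
proof -
  define C where "C = {q. \<forall>z. 0 \<le> qform q z \<and> qform q z \<le> f z}"
  have f0: "f 0 = 0" using hom[of 2 0] by simp
  have f1: "f 1 > 0" using pos by simp
  have "compact C"
    unfolding compact_eq_bounded_closed
  proof
    have "C = (\<Inter>z. {q. 0 \<le> qform q z} \<inter> {q. qform q z \<le> f z})"
      by (auto simp: C_def)
    moreover have "closed ({q. 0 \<le> qform q z} \<inter> {q. qform q z \<le> f z})" for z
      unfolding qform_def by (intro closed_Int closed_Collect_le continuous_intros)
    ultimately show "closed C" by auto
    \<comment> \<open>The diagonal entries are the values at \<open>1\<close> and
      \<open>\<i>\<close>; the value at \<open>1 + \<i>\<close> then controls the mixed
      entry.\<close>
    have "C \<subseteq> {0..f 1} \<times> {- f 1 - f \<i> - f (1 + \<i>)..f 1 + f \<i> + f (1 + \<i>)} \<times> {0..f \<i>}"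
    proof
      fix q assume "q \<in> C"
      then have q: "0 \<le> qform q z" "qform q z \<le> f z" for z by (auto simp: C_def)
      obtain a b c where abc: "q = (a, b, c)" by (cases q) auto
      show "q \<in> {0..f 1} \<times> {- f 1 - f \<i> - f (1 + \<i>)..f 1 + f \<i> + f (1 + \<i>)} \<times> {0..f \<i>}"
        using q[of 1] q[of \<i>] q[of "1 + \<i>"] by (simp add: abc qform_def)
    qed
    then show "bounded C"
      by (rule bounded_subset[rotated]) (intro bounded_Times bounded_closed_interval)
  qed
  \<comment> \<open>The minimum of \<open>f\<close> on the unit circle gives a round form below
    \<open>f\<close>, so the maximal determinant is positive.\<close>
  obtain m where m: "m > 0" "(m, 0, m) \<in> C"
  proof -
    have "compact (sphere (0::complex) 1)" "sphere (0::complex) 1 \<noteq> {}" "continuous_on (sphere 0 1) f"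
      using continuous_on_subset[OF cont] by auto
    then obtain u where u: "u \<in> sphere 0 1" "\<And>z. z \<in> sphere 0 1 \<Longrightarrow> f u \<le> f z"
      using continuous_attains_inf[of "sphere 0 1" f] by auto
    have fu: "f u > 0" using u by (intro pos) auto
    have "qform (f u, 0, f u) z \<le> f z" for z
    proof (cases "z = 0")
      case False
      have "f z = f (norm z *\<^sub>R ((1 / norm z) *\<^sub>R z))" using False by simp
      also have "\<dots> = (norm z)\<^sup>2 * f ((1 / norm z) *\<^sub>R z)" using False by (intro hom) simp
      also have "\<dots> \<ge> (norm z)\<^sup>2 * f u" using False by (intro mult_left_mono u(2)) auto
      also have "(norm z)\<^sup>2 * f u = qform (f u, 0, f u) z"
        by (simp add: qform_def cmod_power2 algebra_simps)
      finally show ?thesis .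
    qed (simp add: qform_def f0)
    moreover have "0 \<le> qform (f u, 0, f u) z" for z using fu by (simp add: qform_def)
    ultimately show ?thesis using that fu by (auto simp: C_def)
  qed
  have "continuous_on C qdet"
    unfolding qdet_def by (intro continuous_intros)
  then obtain q where q: "q \<in> C" "\<And>q'. q' \<in> C \<Longrightarrow> qdet q' \<le> qdet q"
    using continuous_attains_sup[OF \<open>compact C\<close>] m by blast
  define d where "d = qdet q"
  have "d > 0"
    using q(2)[OF m(2)] mult_pos_pos[OF m(1) m(1)] by (simp add: d_def qdet_def)
  have fst_pos: "fst q' > 0" if "q' \<in> C" "qdet q' = d" for q'
  proof -
    have "fst q' \<ge> 0" using that(1) by (auto simp: C_def qform_def dest!: spec[of _ 1])
    moreover have "fst q' \<noteq> 0" using that(2) \<open>d > 0\<close> by (auto simp: qdet_def)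
    ultimately show ?thesis by simp
  qed
  have uniq: "q' = q" if q': "q' \<in> C" "qdet q' = d" for q'
  proof (rule ccontr)
    assume "q' \<noteq> q"
    then have "qdet ((1 / 2) *\<^sub>R (q' + q)) > d"
      by (intro qdet_midpoint[OF fst_pos[OF q'] fst_pos[OF q(1) d_def[symmetric]] q'(2) d_def[symmetric] \<open>d > 0\<close>])
    moreover have "(1 / 2) *\<^sub>R (q' + q) \<in> C"
      unfolding C_def mem_Collect_eq scaleR_add_right qform_scaleR_add
    proof
      fix z
      have "0 \<le> qform q z" "qform q z \<le> f z" "0 \<le> qform q' z" "qform q' z \<le> f z"
        using q(1) q'(1) by (auto simp: C_def)
      then show "0 \<le> 1 / 2 * qform q' z + 1 / 2 * qform q z \<and> 1 / 2 * qform q' z + 1 / 2 * qform q z \<le> f z"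
        by simp
    qed
    ultimately show False using q(2) d_def by fastforce
  qed
  have pull: "qpull A q \<in> C" if "linear A" "\<And>z. f (A z) = f z" for A
    using q(1) that by (auto simp: C_def qform_qpull) metis
  show ?thesis
  proof
    show "qform q z > 0" if "z \<noteq> 0" for z
    proof -
      obtain a b c where abc: "q = (a, b, c)" by (cases q) auto
      have "a > 0" "a * c - b\<^sup>2 > 0"
        using fst_pos[OF q(1)] \<open>d > 0\<close> by (auto simp: abc d_def qdet_def)
      have "a * qform q z = (a * Re z + b * Im z)\<^sup>2 + (a * c - b\<^sup>2) * (Im z)\<^sup>2"
        by (simp add: abc qform_def power2_eq_square algebra_simps)
      also have "\<dots> > 0"
      proof (cases "Im z = 0")
        case True
        then have "Re z \<noteq> 0" using that by (simp add: complex_eq_iff)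
        with True \<open>a > 0\<close> show ?thesis by simp
      next
        case False
        then show ?thesis using \<open>a * c - b\<^sup>2 > 0\<close> by (intro add_nonneg_pos mult_pos_pos) auto
      qed
      finally show ?thesis using \<open>a > 0\<close> by (simp add: zero_less_mult_iff)
    qed
    fix A
    assume A: "linear A" "f \<circ> A = f"
    have "inj A"
      unfolding linear_injective_0[OF A(1)] using f0 pos A(2) by (metis comp_apply less_irrefl)
    then obtain B where B: "linear B" "A \<circ> B = id"
      using linear_surjective_right_inverse[OF A(1)] linear_injective_imp_surjective[OF A(1)] by blast
    have "f \<circ> B = f"
      using A(2) B(2) by (metis comp_assoc comp_id)
    note AB = A(1) B(1) pointfree_idE[OF B(2)] fun_cong[OF A(2), simplified] fun_cong[OF \<open>f \<circ> B = f\<close>, simplified]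
    \<comment> \<open>Pulling back by a symmetry stays in \<open>C\<close>, so it cannot increase
      the maximal determinant. Applied to \<open>A\<close> and to its inverse \<open>B\<close>, this
      forces \<open>(cdet A)\<^sup>2 = 1\<close>; then \<open>qpull A q\<close> is also maximal and
      must be \<open>q\<close>.\<close>
    have le: "(cdet T)\<^sup>2 \<le> 1" if "linear T" "\<And>z. f (T z) = f z" for T
      using q(2)[OF pull[OF that]] \<open>d > 0\<close> by (simp add: qdet_qpull d_def)
    have "(cdet A)\<^sup>2 * (cdet B)\<^sup>2 = 1"
      using cdet_inverse[OF AB(1,3)] by (simp flip: power_mult_distrib)
    moreover have "(cdet A)\<^sup>2 \<le> 1" "(cdet B)\<^sup>2 \<le> 1"
      using le AB by blast+
    then have "(cdet A)\<^sup>2 * (cdet B)\<^sup>2 \<le> (cdet A)\<^sup>2 * 1"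
      by (intro mult_left_mono) auto
    ultimately have "(cdet A)\<^sup>2 = 1" using \<open>(cdet A)\<^sup>2 \<le> 1\<close> by simp
    then have "qpull A q = q"
      by (intro uniq pull AB) (simp add: qdet_qpull d_def)
    then show "qform q \<circ> A = qform q"
      using qform_qpull[OF AB(1), of q] by (auto simp: fun_eq_iff)
  qed
qed

text \<open>Both \<open>f\<close> and its John form are invariant under the symmetries and scale by
  \<open>r\<^sup>2\<close>, so their ratio at any \<open>w\<close> equals the ratio at
  \<open>u\<close>.\<close>

lemma quadratic_of_transitive:
  fixes f :: "complex \<Rightarrow> real"
  assumes cont: "continuous_on UNIV f" and pos: "\<And>z. z \<noteq> 0 \<Longrightarrow> f z > 0"
    and hom: "\<And>r z. r > 0 \<Longrightarrow> f (r *\<^sub>R z) = r\<^sup>2 * f z"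
    and trans: "\<And>w. w \<noteq> 0 \<Longrightarrow> \<exists>A r. linear A \<and> f \<circ> A = f \<and> r > 0 \<and> w = r *\<^sub>R A u"
    and "u \<noteq> 0"
  obtains q where "\<And>z. f z = qform q z"
proof -
  obtain q where q: "\<And>z. z \<noteq> 0 \<Longrightarrow> qform q z > 0"
    "\<And>A. linear A \<Longrightarrow> f \<circ> A = f \<Longrightarrow> qform q \<circ> A = qform q"
    using john_form[OF cont pos hom] by blast
  define c where "c = f u / qform q u"
  have "f w = c * qform q w" for w
  proof (cases "w = 0")
    case True
    then show ?thesis using hom[of 2 0] by (simp add: qform_def)
  next
    case False
    then obtain A r where A: "linear A" "f \<circ> A = f" "r > 0" "w = r *\<^sub>R A u"
      using trans by blast
    have "f w = r\<^sup>2 * f u" using A(3,4) hom fun_cong[OF A(2), of u] by simp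
    also have "f u = c * qform q u" using q(1)[OF \<open>u \<noteq> 0\<close>] by (simp add: c_def)
    also have "qform q u = qform q (A u)" using fun_cong[OF q(2)[OF A(1,2)], of u] by simp
    finally show ?thesis by (simp add: A(4) qform_scaleR)
  qed
  then show ?thesis
    \<comment> \<open>The null summand gives the witness the two-term shape of
      \<open>qform_scaleR_add\<close>.\<close>
    using that[of "c *\<^sub>R q + 0 *\<^sub>R q"] by (simp add: qform_scaleR_add del: scaleR_zero_left)
qed

section \<open>Winding numbers\<close>

text \<open>The solutions of \<open>exp d = 1\<close> are the integer multiples of
  \<open>2 * pi * \<i>\<close>. Distinct ones are at distance at least 1, and a continuous map from
  a connected set to such a discrete set is constant.\<close>

lemma exp_eq_1_imp_constant:
  fixes d :: "'a::topological_space \<Rightarrow> complex"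
  assumes "connected S" "continuous_on S d" "\<And>x. x \<in> S \<Longrightarrow> exp (d x) = 1" "x \<in> S" "y \<in> S"
  shows "d x = d y"
proof -
  have "d constant_on S"
  proof (rule continuous_discrete_range_constant[OF assms(1,2)])
    fix x assume x: "x \<in> S"
    have "1 \<le> norm (d y - d x)" if y: "y \<in> S" "d y \<noteq> d x" for y
    proof -
      obtain m n :: int where mn: "Re (d x) = 0" "Im (d x) = of_int (2 * m) * pi"
          "Re (d y) = 0" "Im (d y) = of_int (2 * n) * pi"
        using assms(3)[OF x] assms(3)[OF y(1)] by (auto simp: exp_eq_1)
      have "n \<noteq> m" using mn y(2) by (auto simp: complex_eq_iff)
      then have "1 \<le> \<bar>real_of_int (n - m)\<bar>" by linarith
      moreover have "1 \<le> 2 * pi" using pi_gt3 by simp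
      ultimately have "1 * 1 \<le> \<bar>real_of_int (n - m)\<bar> * (2 * pi)" by (intro mult_mono) auto
      also have "\<dots> = \<bar>real_of_int (n - m) * (2 * pi)\<bar>" by (simp add: abs_mult)
      also have "real_of_int (n - m) * (2 * pi) = Im (d y - d x)" by (simp add: mn algebra_simps)
      also have "\<bar>Im (d y - d x)\<bar> \<le> norm (d y - d x)" by (rule abs_Im_le_cmod)
      finally show ?thesis by simp
    qed
    then show "\<exists>e>0. \<forall>y. y \<in> S \<and> d y \<noteq> d x \<longrightarrow> e \<le> norm (d y - d x)"
      by (intro exI[of _ 1]) auto
  qed
  then show ?thesis using assms(4,5) by (auto simp: constant_on_def)
qed

text \<open>Along the circles of latitude, from one pole to the other, the winding number of \<open>f\<close> is constant.
  It is \<open>-1\<close> at the first pole, so the loop \<open>w\<close> read off at the second pole winds around twice.\<close>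

lemma loop_meets_every_ray:
  fixes f :: "real \<times> real \<Rightarrow> complex" and w :: "real \<Rightarrow> complex"
  assumes cont: "continuous_on ({0..2 * pi} \<times> {0..b}) f" and "b \<ge> 0"
    and nz: "\<And>\<phi> t. \<phi> \<in> {0..2 * pi} \<Longrightarrow> t \<in> {0..b} \<Longrightarrow> f (\<phi>, t) \<noteq> 0"
    and per: "\<And>t. t \<in> {0..b} \<Longrightarrow> f (2 * pi, t) = f (0, t)"
    and start: "\<And>\<phi>. \<phi> \<in> {0..2 * pi} \<Longrightarrow> f (\<phi>, 0) = cis (- \<phi>)"
    and finish: "\<And>\<phi>. \<phi> \<in> {0..2 * pi} \<Longrightarrow> f (\<phi>, b) = - cnj (w \<phi> * cis (- \<phi>))"
    and "z \<noteq> 0"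
  obtains \<phi> r where "\<phi> \<in> {0..2 * pi}" "r > 0" "z = r *\<^sub>R w \<phi>"
proof -
  let ?S = "{0..2 * pi} \<times> {0..b}"
  have "contractible ?S"
    by (intro convex_imp_contractible convex_Times) auto
  then obtain g where g: "continuous_on ?S g" "\<And>x. x \<in> ?S \<Longrightarrow> f x = exp (g x)"
    using continuous_logarithm_on_contractible[OF cont] nz by (metis (no_types, lifting) mem_Sigma_iff surj_pair)
  have cont_h: "continuous_on {0..b} (\<lambda>t. g (\<phi>, t))" if "\<phi> \<in> {0..2 * pi}" for \<phi>
    by (rule continuous_on_compose2[OF g(1)]) (use that in \<open>auto intro!: continuous_intros\<close>)
  have cont_v: "continuous_on {0..2 * pi} (\<lambda>\<phi>. g (\<phi>, t))" if "t \<in> {0..b}" for t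
    by (rule continuous_on_compose2[OF g(1)]) (use that in \<open>auto intro!: continuous_intros\<close>)
  \<comment> \<open>The increment of the logarithm around a circle of latitude is a multiple of
    \<open>2 * pi * \<i>\<close> that varies continuously with the latitude.\<close>
  have "g (2 * pi, b) - g (0, b) = g (2 * pi, 0) - g (0, 0)"
  proof (rule exp_eq_1_imp_constant[of "{0..b}" "\<lambda>t. g (2 * pi, t) - g (0, t)"])
    show "continuous_on {0..b} (\<lambda>t. g (2 * pi, t) - g (0, t))"
      by (intro continuous_on_diff cont_h) auto
    show "exp (g (2 * pi, t) - g (0, t)) = 1" if "t \<in> {0..b}" for t
      using per[OF that] g(2)[of "(2 * pi, t)"] g(2)[of "(0, t)"] that by (simp add: exp_diff)
  qed (use \<open>b \<ge> 0\<close> in auto)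
  moreover have "g (2 * pi, 0) + \<i> * of_real (2 * pi) = g (0, 0) + \<i> * of_real 0"
  proof (rule exp_eq_1_imp_constant[of "{0..2 * pi}" "\<lambda>\<phi>. g (\<phi>, 0) + \<i> * of_real \<phi>"])
    show "continuous_on {0..2 * pi} (\<lambda>\<phi>. g (\<phi>, 0) + \<i> * of_real \<phi>)"
      using \<open>b \<ge> 0\<close> by (intro continuous_on_add cont_v continuous_intros) auto
    show "exp (g (\<phi>, 0) + \<i> * of_real \<phi>) = 1" if "\<phi> \<in> {0..2 * pi}" for \<phi>
    proof -
      have "exp (g (\<phi>, 0)) = cis (- \<phi>)"
        using start[OF that] g(2)[of "(\<phi>, 0)"] that \<open>b \<ge> 0\<close> by simp
      then show ?thesis by (simp add: exp_add cis_mult flip: cis_conv_exp)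
    qed
  qed auto
  ultimately have total: "g (2 * pi, b) - g (0, b) = - (2 * pi * \<i>)"
    by (simp add: algebra_simps) algebra
  \<comment> \<open>Solving \<open>finish\<close> for \<open>w\<close> gives this logarithm of
    \<open>w\<close>. Conjugation turns the increment \<open>- 2 * pi\<close> of the argument into
    \<open>2 * pi\<close>, and the last summand adds another \<open>2 * pi\<close>.\<close>
  define \<omega> where "\<omega> \<phi> = \<i> * of_real pi + cnj (g (\<phi>, b)) + \<i> * of_real \<phi>" for \<phi>
  have exp_\<omega>: "exp (\<omega> \<phi>) = w \<phi>" if "\<phi> \<in> {0..2 * pi}" for \<phi>
  proof -
    have "exp (\<omega> \<phi>) = - cnj (exp (g (\<phi>, b))) * cis \<phi>"
      unfolding \<omega>_def exp_add by (simp add: exp_cnj cis_conv_exp)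
    also have "exp (g (\<phi>, b)) = - cnj (w \<phi> * cis (- \<phi>))"
      using finish[OF that] g(2)[of "(\<phi>, b)"] that \<open>b \<ge> 0\<close> by simp
    also have "- cnj (- cnj (w \<phi> * cis (- \<phi>))) * cis \<phi> = w \<phi> * (cis (- \<phi>) * cis \<phi>)"
      by (simp del: cis_cnj)
    finally show ?thesis by (simp add: cis_mult)
  qed
  have Im_\<omega>: "Im (\<omega> (2 * pi)) = Im (\<omega> 0) + 4 * pi"
    using arg_cong[OF total, of Im] by (simp add: \<omega>_def)
  \<comment> \<open>This \<open>n\<close> moves the argument of \<open>z\<close> into the first full
    turn after \<open>Im (\<omega> 0)\<close>, well inside the range of length \<open>4 * pi\<close>
    that \<open>\<omega>\<close> sweeps.\<close>
  define n where "n = \<lceil>(Im (\<omega> 0) - Arg z) / (2 * pi)\<rceil>"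
  define \<theta> where "\<theta> = Arg z + 2 * pi * of_int n"
  have "(Im (\<omega> 0) - Arg z) / (2 * pi) \<le> of_int n" "of_int n \<le> (Im (\<omega> 0) - Arg z) / (2 * pi) + 1"
    unfolding n_def by linarith+
  then have "Im (\<omega> 0) - Arg z \<le> of_int n * (2 * pi)" "of_int n * (2 * pi) \<le> Im (\<omega> 0) - Arg z + 2 * pi"
    by (simp_all add: field_simps)
  then have "Im (\<omega> 0) \<le> \<theta>" "\<theta> \<le> Im (\<omega> (2 * pi))"
    unfolding Im_\<omega> \<theta>_def using pi_gt_zero by (simp_all add: algebra_simps) 
  moreover have "continuous_on {0..2 * pi} (\<lambda>\<phi>. Im (\<omega> \<phi>))"
    unfolding \<omega>_def using \<open>b \<ge> 0\<close> by (intro continuous_intros cont_v) auto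
  ultimately obtain \<phi> where \<phi>: "\<phi> \<in> {0..2 * pi}" "Im (\<omega> \<phi>) = \<theta>"
    using IVT'[of "\<lambda>\<phi>. Im (\<omega> \<phi>)" 0 \<theta> "2 * pi"] by auto
  have "cis \<theta> = cis (Arg z)"
    unfolding \<theta>_def by (simp add: cis_mult[symmetric] cis_multiple_2pi)
  then have "w \<phi> = exp (Re (\<omega> \<phi>)) *\<^sub>R cis (Arg z)"
    using exp_\<omega>[OF \<phi>(1)] \<phi>(2) by (metis exp_eq_polar scaleR_conv_of_real)
  moreover have "z = norm z *\<^sub>R cis (Arg z)"
    using rcis_cmod_Arg[of z] by (simp add: rcis_def scaleR_conv_of_real)
  ultimately have "z = (norm z / exp (Re (\<omega> \<phi>))) *\<^sub>R w \<phi>"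
    by simp
  then show ?thesis
    using that[OF \<phi>(1), of "norm z / exp (Re (\<omega> \<phi>))"] \<open>z \<noteq> 0\<close> by simp
qed

section \<open>Covariant derivatives on the sphere\<close>

lemma S2_inner_self: "p \<in> S2 \<Longrightarrow> p \<bullet> p = 1"
  by (simp add: S2_def dist_norm power2_norm_eq_inner[symmetric])

definition tproj :: "real^3 \<Rightarrow> real^3 \<Rightarrow> real^3" where
  "tproj p v = v - (p \<bullet> v) *\<^sub>R p"

lemma tproj_tangent: "p \<in> S2 \<Longrightarrow> tproj p v \<in> tangent_space p"
  by (simp add: tproj_def tangent_space_def inner_diff_right S2_inner_self)

lemma tproj_eq: "v \<in> tangent_space p \<Longrightarrow> tproj p v = v"
  by (simp add: tproj_def tangent_space_def)

lemma tproj_add: "tproj p (v + w) = tproj p v + tproj p w"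
  and tproj_scaleR: "tproj p (r *\<^sub>R v) = r *\<^sub>R tproj p v"
  by (simp_all add: tproj_def algebra_simps inner_add_right)

lemma tproj_Basis: "(\<Sum>b\<in>Basis. (v \<bullet> b) *\<^sub>R tproj p b) = tproj p v"
proof -
  have lin: "linear (tproj p)"
    by (rule linearI) (simp_all add: tproj_add tproj_scaleR)
  have "tproj p v = tproj p (\<Sum>b\<in>Basis. (v \<bullet> b) *\<^sub>R b)"
    by (simp only: euclidean_representation)
  then show ?thesis
    by (simp only: linear_sum[OF lin] linear_scale[OF lin])
qed

lemma smooth_on_tproj:
  assumes "smooth_on A c" "smooth_on A V"
  shows "smooth_on A (\<lambda>t. tproj (c t) (V t))"
  unfolding tproj_def by (intro smooth_on_diff smooth_on_scaleR smooth_on_inner assms)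

lemma vector_field_tproj: "vector_field (\<lambda>p. tproj p b)"
  by (simp add: vector_field_def smooth_on_tproj smooth_on_id smooth_on_const tproj_tangent)

lemma vector_field_add: "vector_field X \<Longrightarrow> vector_field Y \<Longrightarrow> vector_field (\<lambda>p. X p + Y p)"
  and vector_field_scaleR: "smooth_on S2 f \<Longrightarrow> vector_field X \<Longrightarrow> vector_field (\<lambda>p. f p *\<^sub>R X p)"
  and vector_field_zero: "vector_field (\<lambda>p. 0)"
  by (auto simp: vector_field_def smooth_on_add smooth_on_scaleR smooth_on_const tangent_space_def inner_add_right)

lemma vector_field_sum:
  "(\<And>i. i \<in> I \<Longrightarrow> vector_field (X i)) \<Longrightarrow> vector_field (\<lambda>p. \<Sum>i\<in>I. X i p)"
  by (induction I rule: infinite_finite_induct) (auto intro: vector_field_add vector_field_zero)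

lemma vector_field_inner: "vector_field X \<Longrightarrow> smooth_on S2 (\<lambda>p. X p \<bullet> b)"
  by (auto simp: vector_field_def intro: smooth_on_inner smooth_on_const)

text \<open>With \<open>A = S2\<close>, a coefficient that jumps off the sphere is admissible in the
  axioms of a connection. This is how values off the sphere are shown to be irrelevant.\<close>

lemma smooth_on_indicator: "smooth_on A (\<lambda>q. if q \<in> A then r else s)"
  by (rule smooth_on_cong[OF _ smooth_on_const[of A r]]) simp

lemma vector_field_expand:
  assumes "vector_field X" "p \<in> S2"
  shows "(\<Sum>b\<in>Basis. (X p \<bullet> b) *\<^sub>R tproj p b) = X p"
  using assms by (simp add: tproj_Basis tproj_eq vector_field_def)

text \<open>The sphere has no global frame, but the projections of the three constant fields span every
  tangent plane, and a tangent field \<open>X\<close> is the sum of the \<open>(X p \<bullet> b) *\<^sub>R tproj p b\<close>. The Christoffel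
  symbols are taken with respect to this overcomplete family.\<close>

definition christoffel ::
  "((real^3 \<Rightarrow> real^3) \<Rightarrow> (real^3 \<Rightarrow> real^3) \<Rightarrow> real^3 \<Rightarrow> real^3) \<Rightarrow> real^3 \<Rightarrow> real^3 \<Rightarrow> real^3 \<Rightarrow> real^3" where
  "christoffel nabla p x y =
     (\<Sum>b\<in>Basis. \<Sum>b'\<in>Basis. ((y \<bullet> b) * (x \<bullet> b')) *\<^sub>R nabla (\<lambda>p. tproj p b') (\<lambda>p. tproj p b) p)"

lemma christoffel_add: "christoffel nabla p x (y + y') = christoffel nabla p x y + christoffel nabla p x y'"
  and christoffel_scaleR: "christoffel nabla p x (r *\<^sub>R y) = r *\<^sub>R christoffel nabla p x y"
  by (simp_all add: christoffel_def inner_add_left algebra_simps sum.distrib scaleR_sum_right)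

context
  fixes nabla
  assumes nabla: "linear_connection nabla"
begin

lemma nabla_vector_field: "vector_field X \<Longrightarrow> vector_field Y \<Longrightarrow> vector_field (nabla X Y)"
  by (rule nabla[unfolded linear_connection_def, THEN conjunct1, rule_format])

lemma nabla_left:
  "vector_field X \<Longrightarrow> vector_field X' \<Longrightarrow> vector_field Y \<Longrightarrow> smooth_on S2 f \<Longrightarrow> smooth_on S2 g \<Longrightarrow> p \<in> S2 \<Longrightarrow>
     nabla (\<lambda>q. f q *\<^sub>R X q + g q *\<^sub>R X' q) Y p = f p *\<^sub>R nabla X Y p + g p *\<^sub>R nabla X' Y p"
  by (rule nabla[unfolded linear_connection_def, THEN conjunct2, THEN conjunct1, rule_format])

lemma nabla_right:
  "vector_field X \<Longrightarrow> vector_field Y \<Longrightarrow> vector_field Y' \<Longrightarrow> p \<in> S2 \<Longrightarrow>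
     nabla X (\<lambda>q. a *\<^sub>R Y q + b *\<^sub>R Y' q) p = a *\<^sub>R nabla X Y p + b *\<^sub>R nabla X Y' p"
  by (rule nabla[unfolded linear_connection_def, THEN conjunct2, THEN conjunct2, THEN conjunct1, rule_format])

lemma nabla_leibniz:
  "vector_field X \<Longrightarrow> vector_field Y \<Longrightarrow> smooth_on S2 f \<Longrightarrow> p \<in> S2 \<Longrightarrow>
     nabla X (\<lambda>q. f q *\<^sub>R Y q) p = lie_deriv X f p *\<^sub>R Y p + f p *\<^sub>R nabla X Y p"
  by (rule nabla[unfolded linear_connection_def, THEN conjunct2, THEN conjunct2, THEN conjunct2, rule_format])

text \<open>\<open>X\<close> has coefficients 0 and 1 over the pair \<open>X\<close>,
  \<open>X'\<close> on the sphere, and 1 and 0 off it. Linearity over functions sees only the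
  former.\<close>

lemma nabla_cong_left:
  assumes "vector_field X" "vector_field X'" "vector_field Y" "p \<in> S2" "\<And>q. q \<in> S2 \<Longrightarrow> X q = X' q"
  shows "nabla X Y p = nabla X' Y p"
proof -
  have "X = (\<lambda>q. (if q \<in> S2 then 0 else 1) *\<^sub>R X q + (if q \<in> S2 then 1 else 0) *\<^sub>R X' q)"
    using assms(5) by auto
  then have "nabla X Y p = nabla (\<lambda>q. (if q \<in> S2 then 0 else 1) *\<^sub>R X q + (if q \<in> S2 then 1 else 0) *\<^sub>R X' q) Y p"
    by (rule arg_cong)
  also have "\<dots> = nabla X' Y p"
    by (subst nabla_left) (use assms in \<open>auto intro: smooth_on_indicator\<close>)
  finally show ?thesis .
qed

lemma nabla_cong_right:
  assumes "vector_field X" "vector_field Y" "vector_field Y'" "p \<in> S2" "\<And>q. q \<in> S2 \<Longrightarrow> Y q = Y' q"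
  shows "nabla X Y p = nabla X Y' p"
proof -
  let ?D = "\<lambda>q. 1 *\<^sub>R Y q + (-1) *\<^sub>R Y' q"
  have D: "vector_field ?D"
    using assms by (intro vector_field_add vector_field_scaleR smooth_on_const)
  have "?D = (\<lambda>q. (if q \<in> S2 then 0 else 1) *\<^sub>R ?D q)"
    using assms(5) by auto
  then have "nabla X ?D p = nabla X (\<lambda>q. (if q \<in> S2 then 0 else 1) *\<^sub>R ?D q) p"
    by (rule arg_cong)
  \<comment> \<open>Both Leibniz terms vanish: the coefficient is 0 at \<open>p\<close>, and its Lie
    derivative is multiplied by \<open>?D p = 0\<close>.\<close>
  also have "\<dots> = 0"
    by (subst nabla_leibniz[OF assms(1) D smooth_on_indicator assms(4)]) (use assms in auto)
  finally show ?thesis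
    using nabla_right[OF assms(1-4), of 1 "-1"] by simp
qed

lemma nabla_sum_left:
  assumes "vector_field Y" "p \<in> S2" "finite I"
    "\<And>i. i \<in> I \<Longrightarrow> vector_field (X i)" "\<And>i. i \<in> I \<Longrightarrow> smooth_on S2 (f i)"
  shows "nabla (\<lambda>q. \<Sum>i\<in>I. f i q *\<^sub>R X i q) Y p = (\<Sum>i\<in>I. f i p *\<^sub>R nabla (X i) Y p)"
  using assms(3-)
proof (induction I rule: finite_induct)
  case empty
  show ?case
    using nabla_left[OF vector_field_zero vector_field_zero assms(1) smooth_on_const[of S2 0] smooth_on_const[of S2 0] assms(2)]
    by simp
next
  case (insert i I)
  have "nabla (\<lambda>q. f i q *\<^sub>R X i q + 1 *\<^sub>R (\<Sum>i\<in>I. f i q *\<^sub>R X i q)) Y p =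
      f i p *\<^sub>R nabla (X i) Y p + 1 *\<^sub>R nabla (\<lambda>q. \<Sum>i\<in>I. f i q *\<^sub>R X i q) Y p"
    using insert.prems assms(1,2)
    by (intro nabla_left vector_field_sum vector_field_scaleR smooth_on_const) auto
  then show ?case
    using insert by simp
qed

lemma nabla_sum_right:
  assumes "vector_field X" "p \<in> S2" "finite I"
    "\<And>i. i \<in> I \<Longrightarrow> vector_field (Y i)" "\<And>i. i \<in> I \<Longrightarrow> smooth_on S2 (f i)"
  shows "nabla X (\<lambda>q. \<Sum>i\<in>I. f i q *\<^sub>R Y i q) p =
    (\<Sum>i\<in>I. lie_deriv X (f i) p *\<^sub>R Y i p + f i p *\<^sub>R nabla X (Y i) p)"
  using assms(3-)
proof (induction I rule: finite_induct)
  case empty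
  show ?case
    using nabla_right[OF assms(1) vector_field_zero vector_field_zero assms(2), of 0 0] by simp
next
  case (insert i I)
  have "nabla X (\<lambda>q. 1 *\<^sub>R (f i q *\<^sub>R Y i q) + 1 *\<^sub>R (\<Sum>i\<in>I. f i q *\<^sub>R Y i q)) p =
      1 *\<^sub>R nabla X (\<lambda>q. f i q *\<^sub>R Y i q) p + 1 *\<^sub>R nabla X (\<lambda>q. \<Sum>i\<in>I. f i q *\<^sub>R Y i q) p"
    using insert.prems assms(1,2) by (intro nabla_right vector_field_sum vector_field_scaleR) auto
  moreover have "nabla X (\<lambda>q. f i q *\<^sub>R Y i q) p = lie_deriv X (f i) p *\<^sub>R Y i p + f i p *\<^sub>R nabla X (Y i) p"
    using insert.prems assms(1,2) by (intro nabla_leibniz) auto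
  ultimately show ?case
    using insert by simp
qed

text \<open>Both fields are expanded in the projected constant fields, \<open>Y\<close> by the
  Leibniz rule and \<open>X\<close> by linearity over functions. Only \<open>X p\<close>,
  \<open>Y p\<close> and the derivatives of \<open>Y\<close> in the direction \<open>X p\<close>
  remain, all of which have a meaning along a curve.\<close>

lemma nabla_eq_christoffel:
  assumes X: "vector_field X" and Y: "vector_field Y" and p: "p \<in> S2"
  shows "nabla X Y p = (\<Sum>b\<in>Basis. lie_deriv X (\<lambda>q. Y q \<bullet> b) p *\<^sub>R tproj p b) + christoffel nabla p (X p) (Y p)"
proof -
  have left: "nabla X (\<lambda>p. tproj p b) p = (\<Sum>b'\<in>Basis. (X p \<bullet> b') *\<^sub>R nabla (\<lambda>p. tproj p b') (\<lambda>p. tproj p b) p)" for b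
  proof -
    have "nabla X (\<lambda>p. tproj p b) p = nabla (\<lambda>q. \<Sum>b\<in>Basis. (X q \<bullet> b) *\<^sub>R tproj q b) (\<lambda>p. tproj p b) p"
      using X p by (intro nabla_cong_left)
        (auto intro!: vector_field_tproj vector_field_sum vector_field_scaleR vector_field_inner simp: vector_field_expand)
    then show ?thesis
      using X p by (simp add: nabla_sum_left vector_field_tproj vector_field_inner)
  qed
  have "nabla X Y p = nabla X (\<lambda>q. \<Sum>b\<in>Basis. (Y q \<bullet> b) *\<^sub>R tproj q b) p"
    using X Y p by (intro nabla_cong_right)
      (auto intro!: vector_field_tproj vector_field_sum vector_field_scaleR vector_field_inner simp: vector_field_expand)
  then show ?thesis
    using X Y p by (simp add: nabla_sum_right vector_field_tproj vector_field_inner sum.distrib left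
        christoffel_def scaleR_sum_right)
qed

lemma christoffel_tangent: "p \<in> S2 \<Longrightarrow> christoffel nabla p x y \<in> tangent_space p"
  using nabla_vector_field[OF vector_field_tproj vector_field_tproj]
  by (simp add: christoffel_def tangent_space_def inner_sum_right vector_field_def)

lemma smooth_on_christoffel:
  assumes "smooth_on A c" "smooth_on A x" "smooth_on A y" "c ` A \<subseteq> S2"
  shows "smooth_on A (\<lambda>t. christoffel nabla (c t) (x t) (y t))"
  unfolding christoffel_def
  using nabla_vector_field[OF vector_field_tproj vector_field_tproj] assms
  by (intro smooth_on_sum smooth_on_scaleR smooth_on_mult smooth_on_inner smooth_on_const
      smooth_on_compose[OF assms(1) _ assms(4)]) (auto simp: vector_field_def)

end

text \<open>The formula of \<open>nabla_eq_christoffel\<close> with the Lie derivatives of the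
  components replaced by time derivatives; by \<open>tproj_Basis\<close> their sum is the projection
  of the derivative of \<open>V\<close>.\<close>

definition cov_along ::
  "((real^3 \<Rightarrow> real^3) \<Rightarrow> (real^3 \<Rightarrow> real^3) \<Rightarrow> real^3 \<Rightarrow> real^3) \<Rightarrow> real \<Rightarrow> real \<Rightarrow> (real \<Rightarrow> real^3) \<Rightarrow>
   (real \<Rightarrow> real^3) \<Rightarrow> real \<Rightarrow> real^3" where
  "cov_along nabla a b c V t = tproj (c t) (vector_derivative V (at t within {a..b})) +
     christoffel nabla (c t) (vector_derivative c (at t within {a..b})) (V t)"

text \<open>The chain rule holds for any derivative within the sphere, as the curve stays on it; so
  the choice in \<open>lie_deriv\<close> has no effect on velocities.\<close>

lemma lie_deriv_along:
  assumes c: "smooth_curve a b c" and f: "smooth_on S2 f" and t: "t \<in> {a..b}"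
    and X: "X (c t) = vector_derivative c (at t within {a..b})"
  shows "((\<lambda>\<tau>. f (c \<tau>)) has_vector_derivative lie_deriv X f (c t)) (at t within {a..b})"
proof -
  let ?c' = "vector_derivative c (at t within {a..b})"
  let ?f' = "frechet_derivative f (at (c t) within S2)"
  have sub: "c ` {a..b} \<subseteq> S2" and sm: "smooth_on {a..b} c"
    using c by (auto simp: smooth_curve_def)
  have f': "(f has_derivative ?f') (at (c t) within S2)"
    by (rule smooth_on_has_derivative[OF f]) (use sub t in auto)
  have "(c has_derivative (\<lambda>h. h *\<^sub>R ?c')) (at t within {a..b})"
    using smooth_on_has_vector_derivative[OF sm t] by (simp add: has_vector_derivative_def)
  from diff_chain_within[OF this has_derivative_subset[OF f' sub]]
  have "((\<lambda>\<tau>. f (c \<tau>)) has_derivative (\<lambda>h. ?f' (h *\<^sub>R ?c'))) (at t within {a..b})"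
    by (simp add: o_def)
  then show ?thesis
    by (simp add: has_vector_derivative_def lie_deriv_def X linear_scale[OF has_derivative_linear[OF f']])
qed

text \<open>Parallelism asks for some covariant derivative along the curve that annihilates the
  field. This provides an explicit one.\<close>

lemma cov_deriv_along_cov_along:
  assumes nabla: "linear_connection nabla" and c: "smooth_curve a b c"
  shows "cov_deriv_along nabla a b c (cov_along nabla a b c)"
proof -
  have sub: "c ` {a..b} \<subseteq> S2" and sm: "smooth_on {a..b} c" and "a < b"
    using c by (auto simp: smooth_curve_def)
  note vd = vector_derivative_within_closed_interval[OF \<open>a < b\<close>]
  note hvd = smooth_on_has_vector_derivative[of a b]
  show ?thesis
    unfolding cov_deriv_along_def
  proof (intro conjI allI impI ballI)
    fix V assume V: "field_along a b c V"
    show "field_along a b c (cov_along nabla a b c V)"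
      unfolding field_along_def cov_along_def
    proof (intro conjI ballI)
      show "smooth_on {a..b} (\<lambda>t. tproj (c t) (vector_derivative V (at t within {a..b})) +
          christoffel nabla (c t) (vector_derivative c (at t within {a..b})) (V t))"
        using V \<open>a < b\<close> sm sub
        by (intro smooth_on_add smooth_on_tproj smooth_on_christoffel nabla smooth_on_vector_derivative)
          (auto simp: field_along_def)
      fix t assume "t \<in> {a..b}"
      then have "c t \<in> S2" using sub by auto
      then show "tproj (c t) (vector_derivative V (at t within {a..b})) +
          christoffel nabla (c t) (vector_derivative c (at t within {a..b})) (V t) \<in> tangent_space (c t)"
        using tproj_tangent[of "c t"] christoffel_tangent[OF nabla, of "c t"]
        by (simp add: tangent_space_def inner_add_right)
    qed
  next
    fix V W r s t
    assume V: "field_along a b c V" and W: "field_along a b c W" and t: "t \<in> {a..b}"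
    have "((\<lambda>\<tau>. r *\<^sub>R V \<tau> + s *\<^sub>R W \<tau>) has_vector_derivative
        r *\<^sub>R vector_derivative V (at t within {a..b}) + s *\<^sub>R vector_derivative W (at t within {a..b})) (at t within {a..b})"
      using V W t
      by (intro has_vector_derivative_add bounded_linear.has_vector_derivative[OF bounded_linear_scaleR_right] hvd)
        (auto simp: field_along_def)
    from vd[OF t this] show "cov_along nabla a b c (\<lambda>\<tau>. r *\<^sub>R V \<tau> + s *\<^sub>R W \<tau>) t =
        r *\<^sub>R cov_along nabla a b c V t + s *\<^sub>R cov_along nabla a b c W t"
      by (simp add: cov_along_def tproj_add tproj_scaleR christoffel_add christoffel_scaleR scaleR_add_right)
  next
    fix V and f :: "real \<Rightarrow> real" and t
    assume V: "field_along a b c V" and f: "smooth_on {a..b} f" and t: "t \<in> {a..b}"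
    have "((\<lambda>\<tau>. f \<tau> *\<^sub>R V \<tau>) has_vector_derivative
        f t *\<^sub>R vector_derivative V (at t within {a..b}) + vector_derivative f (at t within {a..b}) *\<^sub>R V t) (at t within {a..b})"
      using V f t
      by (intro has_vector_derivative_scaleR)
        (auto simp: field_along_def has_real_derivative_iff_has_vector_derivative intro: hvd)
    from vd[OF t this] show "cov_along nabla a b c (\<lambda>\<tau>. f \<tau> *\<^sub>R V \<tau>) t =
        vector_derivative f (at t within {a..b}) *\<^sub>R V t + f t *\<^sub>R cov_along nabla a b c V t"
      using V t by (simp add: cov_along_def tproj_add tproj_scaleR christoffel_scaleR scaleR_add_right
          tproj_eq field_along_def)
  next
    fix X Y t
    assume X: "vector_field X" and Y: "vector_field Y" and t: "t \<in> {a..b}"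
      and Xc: "X (c t) = vector_derivative c (at t within {a..b})"
    let ?Y' = "vector_derivative (\<lambda>\<tau>. Y (c \<tau>)) (at t within {a..b})"
    have Y': "((\<lambda>\<tau>. Y (c \<tau>)) has_vector_derivative ?Y') (at t within {a..b})"
      using Y sub by (intro hvd t smooth_on_compose[OF sm]) (auto simp: vector_field_def)
    have "lie_deriv X (\<lambda>q. Y q \<bullet> b') (c t) = ?Y' \<bullet> b'" for b'
    proof -
      have "((\<lambda>\<tau>. Y (c \<tau>) \<bullet> b') has_vector_derivative ?Y' \<bullet> b') (at t within {a..b})"
        by (rule bounded_linear.has_vector_derivative[OF bounded_linear_inner_left Y'])
      from vd[OF t this] vd[OF t lie_deriv_along[of a b c "\<lambda>q. Y q \<bullet> b'" t X, OF c vector_field_inner[OF Y, of b'] t Xc]]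
      show ?thesis by simp
    qed
    moreover have "c t \<in> S2" using sub t by auto
    ultimately show "cov_along nabla a b c (\<lambda>\<tau>. Y (c \<tau>)) t = nabla X Y (c t)"
      using nabla_eq_christoffel[OF nabla X Y, of "c t"] by (simp add: cov_along_def tproj_Basis Xc)
  qed
qed

lemma compatible_parallel:
  assumes "linear_connection nabla" "compatible nabla F" "smooth_curve a b c" "field_along a b c V"
    and "\<And>t. t \<in> {a..b} \<Longrightarrow> cov_along nabla a b c V t = 0"
  shows "F (c b, V b) = F (c a, V a)"
proof -
  have "parallel_transport nabla a b c (V a) (V b)"
    unfolding parallel_transport_def parallel_along_def
    using assms(4,5) cov_deriv_along_cov_along[OF assms(1,3)] by blast
  then show ?thesis using assms(2,3) unfolding compatible_def by blast
qed

section \<open>Transport along the meridians\<close>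

text \<open>The complex plane as the horizontal plane, which is the tangent plane at both
  poles.\<close>

definition hor :: "complex \<Rightarrow> real^3" where
  "hor z = Re z *\<^sub>R axis 1 1 + Im z *\<^sub>R axis 2 1"

definition north :: "real^3" where
  "north = axis 3 1"

text \<open>For \<open>z\<close> on the unit circle, \<open>z\<close> is the longitude and
  \<open>t\<close> the angle from the north pole. All meridians reach \<open>- north\<close> at
  \<open>t = pi\<close>.\<close>

definition merid :: "complex \<Rightarrow> real \<Rightarrow> real^3" where
  "merid z t = cos t *\<^sub>R north + sin t *\<^sub>R hor z"

definition mvel :: "complex \<Rightarrow> real \<Rightarrow> real^3" where
  "mvel z t = cos t *\<^sub>R hor z - sin t *\<^sub>R north"

lemma inner_frame [simp]:
  "north \<bullet> north = 1" "north \<bullet> hor z = 0" "hor z \<bullet> north = 0" "hor z \<bullet> hor w = Re z * Re w + Im z * Im w"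
  by (simp_all add: hor_def north_def inner_add_left inner_add_right inner_axis_axis)

lemma unit_complex: "norm z = 1 \<Longrightarrow> Re z * Re z + Im z * Im z = 1"
  by (metis cmod_power2 one_power2 power2_eq_square)

lemma merid_inner:
  assumes "norm z = 1"
  shows "merid z t \<bullet> merid z t = 1" "merid z t \<bullet> mvel z t = 0" "mvel z t \<bullet> mvel z t = 1"
  using unit_complex[OF assms] sin_cos_squared_add[of t]
  by (simp_all add: merid_def mvel_def inner_add_left inner_add_right inner_diff_left inner_diff_right power2_eq_square)

lemma merid_S2: "norm z = 1 \<Longrightarrow> merid z t \<in> S2"
  using merid_inner(1)[of z t] by (simp add: S2_def norm_eq_sqrt_inner)

lemma merid_has_vector_derivative: "(merid z has_vector_derivative mvel z t) (at t within A)"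
  unfolding merid_def mvel_def
  by (auto intro!: derivative_eq_intros simp: has_real_derivative_iff_has_vector_derivative[symmetric])

lemma smooth_on_sin: "smooth_on A (sin :: real \<Rightarrow> real)" and smooth_on_cos: "smooth_on A (cos :: real \<Rightarrow> real)"
  using Ck_on_sin_cos by (auto intro: Ck_on_imp_smooth_on[of UNIV])

lemma smooth_on_merid: "smooth_on A (merid z)" and smooth_on_mvel: "smooth_on A (mvel z)"
  unfolding merid_def mvel_def
  by (intro smooth_on_add smooth_on_diff smooth_on_scaleR smooth_on_sin smooth_on_cos smooth_on_const)+

lemma smooth_curve_merid: "norm z = 1 \<Longrightarrow> a < b \<Longrightarrow> smooth_curve a b (merid z)"
  by (auto simp: smooth_curve_def smooth_on_merid merid_S2)

lemma continuous_on_hor [continuous_intros]: "continuous_on A f \<Longrightarrow> continuous_on A (\<lambda>x. hor (f x))"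
  unfolding hor_def by (intro continuous_intros)

lemma continuous_on_merid: "continuous_on A (\<lambda>(z, t). merid z t)"
  and continuous_on_mvel: "continuous_on A (\<lambda>(z, t). mvel z t)"
  unfolding merid_def mvel_def case_prod_unfold by (intro continuous_intros)+

text \<open>The right hand side of the parallel transport equation. The first term makes
  \<open>merid z t \<bullet> V t\<close> constant, so that a solution starting tangent to the sphere stays tangent.\<close>

definition transport_gen ::
  "((real^3 \<Rightarrow> real^3) \<Rightarrow> (real^3 \<Rightarrow> real^3) \<Rightarrow> real^3 \<Rightarrow> real^3) \<Rightarrow> complex \<times> real \<Rightarrow> (real^3) \<Rightarrow>\<^sub>L (real^3)" where
  "transport_gen nabla = (\<lambda>(z, t). Blinfun (\<lambda>v.
     - (mvel z t \<bullet> v) *\<^sub>R merid z t - christoffel nabla (merid z t) (mvel z t) v))"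

lemma transport_gen_apply:
  "blinfun_apply (transport_gen nabla (z, t)) v =
     - (mvel z t \<bullet> v) *\<^sub>R merid z t - christoffel nabla (merid z t) (mvel z t) v"
proof -
  have "linear (\<lambda>v. - (mvel z t \<bullet> v) *\<^sub>R merid z t - christoffel nabla (merid z t) (mvel z t) v)"
    by (rule linearI) (simp_all add: inner_add_right christoffel_add christoffel_scaleR algebra_simps)
  then show ?thesis
    by (simp add: transport_gen_def bounded_linear_Blinfun_apply linear_linear)
qed

lemma continuous_on_transport_gen:
  assumes "linear_connection nabla"
  shows "continuous_on (sphere 0 1 \<times> UNIV) (transport_gen nabla)"
proof (rule continuous_on_blinfun_componentwise)
  fix i :: "real^3"
  have "continuous_on (sphere 0 1 \<times> UNIV) (\<lambda>x. nabla (\<lambda>p. tproj p b') (\<lambda>p. tproj p b) (merid (fst x) (snd x)))" for b b'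
  proof (rule continuous_on_compose2[where t=S2 and g="nabla (\<lambda>p. tproj p b') (\<lambda>p. tproj p b)"
        and f="\<lambda>x. merid (fst x) (snd x)"])
    show "continuous_on S2 (nabla (\<lambda>p. tproj p b') (\<lambda>p. tproj p b))"
      using nabla_vector_field[OF assms vector_field_tproj vector_field_tproj]
      by (auto simp: vector_field_def intro: smooth_on_imp_continuous_on)
    show "continuous_on (sphere 0 1 \<times> UNIV) (\<lambda>x. merid (fst x) (snd x))"
      using continuous_on_merid by (simp add: case_prod_unfold)
  qed (auto simp: merid_S2)
  moreover have "blinfun_apply (transport_gen nabla x) i =
      - (mvel (fst x) (snd x) \<bullet> i) *\<^sub>R merid (fst x) (snd x) - christoffel nabla (merid (fst x) (snd x)) (mvel (fst x) (snd x)) i" for x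
    using transport_gen_apply[of nabla "fst x" "snd x" i] by simp
  ultimately show "continuous_on (sphere 0 1 \<times> UNIV) (\<lambda>x. blinfun_apply (transport_gen nabla x) i)"
    using continuous_on_merid continuous_on_mvel
    unfolding christoffel_def case_prod_unfold by (auto intro!: continuous_intros)
qed

lemma merid_transport:
  assumes nabla: "linear_connection nabla" and z: "norm z = 1"
    and V': "\<And>t. (V has_vector_derivative blinfun_apply (transport_gen nabla (z, t)) (V t)) (at t)"
  shows "smooth_on A V" and "merid z t \<bullet> V t = north \<bullet> V 0"
    and "north \<bullet> V 0 = 0 \<Longrightarrow> a < b \<Longrightarrow> s \<in> {a..b} \<Longrightarrow> cov_along nabla a b (merid z) V s = 0"
proof -
  let ?G = "\<lambda>b' b t. nabla (\<lambda>p. tproj p b') (\<lambda>p. tproj p b) (merid z t)"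
  have smG: "smooth_on UNIV (?G b' b)" for b' b
    using nabla_vector_field[OF nabla vector_field_tproj vector_field_tproj]
    by (intro smooth_on_compose[OF smooth_on_merid, where B=S2]) (auto simp: vector_field_def merid_S2 z)
  \<comment> \<open>Bootstrapping: the right hand side of the equation is as regular as
    \<open>V\<close>, so \<open>V\<close> gains one derivative at each step.\<close>
  have "Ck_on k UNIV V" for k
  proof (induction k)
    case 0
    show ?case
      using V' by (auto simp: continuous_on_eq_continuous_at intro: has_vector_derivative_continuous)
  next
    case (Suc k)
    have neg: "Ck_on k UNIV (\<lambda>t. f t - g t)" if "Ck_on k UNIV f" "Ck_on k UNIV g" for f g :: "real \<Rightarrow> real^3"
      using Ck_on_add[OF open_UNIV that(1) Ck_on_bilinear[OF open_UNIV bounded_bilinear_scaleR Ck_on_const[OF open_UNIV, of k "-1"] that(2)]]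
      by simp
    have "Ck_on k UNIV (\<lambda>t. v *\<^sub>R ((- (mvel z t \<bullet> V t)) *\<^sub>R merid z t - christoffel nabla (merid z t) (mvel z t) (V t)))" for v :: real
      unfolding christoffel_def inner_minus_left[symmetric]
      by (intro neg Ck_on_sum Ck_on_const Ck_on_bilinear[OF _ bounded_bilinear_scaleR] Ck_on_bilinear[OF _ bounded_bilinear_inner]
          Ck_on_bilinear[OF _ bounded_bilinear_mult] open_UNIV Suc smooth_on_UNIV_imp_Ck_on smG smooth_on_merid smooth_on_mvel
          smooth_on_linear_compose[OF bounded_linear_minus[OF bounded_linear_ident]])
    then show ?case
      using V' by (intro Ck_on_SucI[where f'="\<lambda>t v. v *\<^sub>R blinfun_apply (transport_gen nabla (z, t)) (V t)"])
        (auto simp: has_vector_derivative_def transport_gen_apply)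
  qed
  then show smV: "smooth_on A V" for A
    by (intro Ck_on_imp_smooth_on[of UNIV]) auto
  have tang: "merid z s \<bullet> christoffel nabla (merid z s) x y = 0" for s x y
    using christoffel_tangent[OF nabla merid_S2[OF z]] by (simp add: tangent_space_def)
  have "((\<lambda>t. merid z t \<bullet> V t) has_vector_derivative
      merid z s \<bullet> blinfun_apply (transport_gen nabla (z, s)) (V s) + mvel z s \<bullet> V s) (at s)" for s
    by (rule bounded_bilinear.has_vector_derivative[OF bounded_bilinear_inner merid_has_vector_derivative V'])
  moreover have "merid z s \<bullet> blinfun_apply (transport_gen nabla (z, s)) (V s) + mvel z s \<bullet> V s = 0" for s
    by (simp add: transport_gen_apply inner_diff_right tang merid_inner(1)[OF z])
  ultimately have "DERIV (\<lambda>t. merid z t \<bullet> V t) s :> 0" for s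
    by (simp add: has_real_derivative_iff_has_vector_derivative)
  then have const: "merid z t \<bullet> V t = merid z 0 \<bullet> V 0" for t
    using DERIV_isconst_all by blast
  then show "merid z t \<bullet> V t = north \<bullet> V 0"
    by (simp add: merid_def)
  show "cov_along nabla a b (merid z) V s = 0" if "north \<bullet> V 0 = 0" "a < b" "s \<in> {a..b}"
  proof -
    have "vector_derivative V (at s within {a..b}) = blinfun_apply (transport_gen nabla (z, s)) (V s)"
      by (rule vector_derivative_within_closed_interval[OF that(2,3) has_vector_derivative_at_within[OF V']])
    moreover have "vector_derivative (merid z) (at s within {a..b}) = mvel z s"
      by (rule vector_derivative_within_closed_interval[OF that(2,3) merid_has_vector_derivative])
    \<comment> \<open>The projection removes the term along \<open>merid z s\<close>, and what is
      left is minus the Christoffel term.\<close>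
    ultimately show ?thesis
      by (simp add: cov_along_def transport_gen_apply tproj_def inner_diff_right tang merid_inner(1)[OF z])
  qed
qed

text \<open>\<open>U\<close> acts on all of three-space, so that its continuity in \<open>z\<close>
  can be stated in one fixed space of operators. Conservation of the normal component makes it
  restrict to the tangent planes.\<close>

lemma meridian_transport_exists:
  assumes nabla: "linear_connection nabla" and F: "compatible nabla F"
  obtains U where "continuous_on (sphere 0 1 \<times> UNIV) U" "\<And>z. norm z = 1 \<Longrightarrow> U (z, 0) = id_blinfun"
    "\<And>z t v. norm z = 1 \<Longrightarrow> merid z t \<bullet> blinfun_apply (U (z, t)) v = north \<bullet> v"
    "\<And>z t v. norm z = 1 \<Longrightarrow> t \<ge> 0 \<Longrightarrow> north \<bullet> v = 0 \<Longrightarrow>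
       F (merid z t, blinfun_apply (U (z, t)) v) = F (north, v)"
proof -
  obtain U where U: "continuous_on (sphere 0 1 \<times> UNIV) U"
    "\<And>z. z \<in> sphere 0 1 \<Longrightarrow> U (z, 0) = id_blinfun"
    "\<And>z t. z \<in> sphere 0 1 \<Longrightarrow> ((\<lambda>t. U (z, t)) has_vector_derivative transport_gen nabla (z, t) o\<^sub>L U (z, t)) (at t)"
    using linear_ode_with_parameter[OF compact_sphere continuous_on_transport_gen[OF nabla]] by blast
  have V': "((\<lambda>t. blinfun_apply (U (z, t)) v) has_vector_derivative
      blinfun_apply (transport_gen nabla (z, t)) (blinfun_apply (U (z, t)) v)) (at t)" if "norm z = 1" for z t v
    using bounded_linear.has_vector_derivative[OF blinfun.bounded_linear_left U(3)[of z t]] that by simp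
  show ?thesis
  proof
    show U0: "U (z, 0) = id_blinfun" if "norm z = 1" for z
      using that U(2) by simp
    show inv: "merid z t \<bullet> blinfun_apply (U (z, t)) v = north \<bullet> v" if "norm z = 1" for z t v
      using merid_transport(2)[OF nabla that V'[OF that]] U0[OF that] by simp
    show "F (merid z t, blinfun_apply (U (z, t)) v) = F (north, v)" if "norm z = 1" "t \<ge> 0" "north \<bullet> v = 0" for z t v
    \<comment> \<open>Curves are defined on nondegenerate intervals, so \<open>t = 0\<close> is
      separate.\<close>
    proof (cases "t = 0")
      case False
      let ?V = "\<lambda>t. blinfun_apply (U (z, t)) v"
      have "field_along 0 t (merid z) ?V"
        using merid_transport(1)[OF nabla that(1) V'[OF that(1)]] inv[OF that(1)] that(3)
        by (simp add: field_along_def tangent_space_def)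
      then have "F (merid z t, ?V t) = F (merid z 0, ?V 0)"
        using merid_transport(3)[OF nabla that(1) V'[OF that(1)]] U0[OF that(1)] that False
        by (intro compatible_parallel[OF nabla F smooth_curve_merid]) auto
      then show ?thesis using U0[OF that(1)] by (simp add: merid_def)
    qed (use U0[OF that(1)] in \<open>simp add: merid_def\<close>)
  qed (rule U(1))
qed

lemma S2_merid:
  assumes "p \<in> S2"
  obtains z t where "norm z = 1" "t \<in> {0..pi}" "p = merid z t"
proof -
  have p: "p = (p $ 3) *\<^sub>R axis 3 1 + ((p $ 1) *\<^sub>R axis 1 1 + (p $ 2) *\<^sub>R axis 2 1)"
    by (simp add: vec_eq_iff forall_3 axis_def)
  have sum: "(p $ 1)\<^sup>2 + (p $ 2)\<^sup>2 + (p $ 3)\<^sup>2 = 1"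
    using S2_inner_self[OF assms] by (simp add: inner_vec_def sum_3 power2_eq_square)
  define w where "w = Complex (p $ 1) (p $ 2)"
  \<comment> \<open>At the poles \<open>w = 0\<close> and any longitude will do.\<close>
  define z where "z = (if w = 0 then 1 else sgn w)"
  have "(p $ 3)\<^sup>2 \<le> 1" using sum by (smt (verit) zero_le_power2)
  then have p3: "\<bar>p $ 3\<bar> \<le> 1" by (simp add: abs_square_le_1)
  have "sin (arccos (p $ 3)) = norm w"
    using sum p3 by (simp add: sin_arccos_abs w_def cmod_def algebra_simps)
  moreover have "norm w *\<^sub>R z = w"
    by (auto simp: z_def sgn_div_norm)
  ultimately have "sin (arccos (p $ 3)) *\<^sub>R hor z = hor w"
    by (auto simp: hor_def scaleR_add_right)
      (metis scaleR_complex.simps real_scaleR_def)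
  moreover have "p = (p $ 3) *\<^sub>R north + hor w"
    unfolding hor_def north_def w_def complex.sel by (rule p)
  ultimately have "p = merid z (arccos (p $ 3))"
    using p3 by (simp add: merid_def abs_le_iff)
  moreover have "norm z = 1" by (simp add: z_def norm_sgn)
  moreover have "arccos (p $ 3) \<in> {0..pi}" using p3 by (auto simp: abs_le_iff arccos_lbound arccos_ubound)
  ultimately show ?thesis using that by blast
qed

section \<open>The Finsler norms are Euclidean\<close>

definition dehor :: "real^3 \<Rightarrow> complex" where
  "dehor v = Complex (v $ 1) (v $ 2)"

lemma linear_hor: "linear hor"
  by (rule linearI) (simp_all add: hor_def algebra_simps)

lemma linear_dehor: "linear dehor"
  by (rule linearI) (simp_all add: dehor_def complex_eq_iff)

lemma dehor_hor: "dehor (hor z) = z"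
  by (simp add: dehor_def hor_def axis_def complex_eq_iff)

lemma hor_dehor:
  assumes "north \<bullet> v = 0" shows "hor (dehor v) = v"
proof -
  have "v $ 3 = 0" using assms by (simp add: north_def inner_axis')
  then show ?thesis by (simp add: dehor_def hor_def vec_eq_iff forall_3 axis_def)
qed

text \<open>The three vectors form an orthonormal frame. Rotating the first two back by the angle
  \<open>t\<close> recovers the components along \<open>north\<close> and
  \<open>hor z\<close>.\<close>

lemma merid_frame_eq_0:
  assumes z: "norm z = 1" and "merid z t \<bullet> v = 0" "mvel z t \<bullet> v = 0" "hor (\<i> * z) \<bullet> v = 0"
  shows "v = 0"
proof -
  have "cos t * (merid z t \<bullet> v) - sin t * (mvel z t \<bullet> v) = ((sin t)\<^sup>2 + (cos t)\<^sup>2) * (north \<bullet> v)"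
    by (simp only: merid_def mvel_def inner_add_left inner_diff_left inner_scaleR_left) algebra
  then have n: "north \<bullet> v = 0" using assms by simp
  have "sin t * (merid z t \<bullet> v) + cos t * (mvel z t \<bullet> v) = ((sin t)\<^sup>2 + (cos t)\<^sup>2) * (hor z \<bullet> v)"
    by (simp only: merid_def mvel_def inner_add_left inner_diff_left inner_scaleR_left) algebra
  then have h: "hor z \<bullet> v = 0" using assms by simp
  obtain a where a: "v = hor a" using hor_dehor[OF n] by metis
  have "Re z * Re a + Im z * Im a = 0" "Re z * Im a - Im z * Re a = 0"
    using h assms(4) by (simp_all add: a algebra_simps)
  \<comment> \<open>The two equations are the real and imaginary parts of this one.\<close>
  then have "cnj z * a = 0" by (simp add: complex_eq_iff algebra_simps)
  then show ?thesis using z a by (auto simp: linear_0[OF linear_hor])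
qed

lemma finsler_scale:
  assumes "finsler_metric F" "p \<in> S2" "v \<in> tangent_space p" "r > 0"
  shows "F (p, r *\<^sub>R v) = r * F (p, v)"
proof -
  have "\<forall>(p, v)\<in>TS2. \<forall>t>0. F (p, t *\<^sub>R v) = t * F (p, v)"
    using assms(1) unfolding finsler_metric_def by (elim conjE)
  from bspec[OF this, of "(p, v)"] show ?thesis
    using assms(2-4) by (simp add: TS2_def)
qed

lemma finsler_zero:
  assumes "finsler_metric F" "p \<in> S2"
  shows "F (p, 0) = 0"
  using finsler_scale[OF assms, of 0 2] by (simp add: tangent_space_def)

text \<open>By homogeneity the Hessian at \<open>v\<close> in the direction \<open>v\<close> is \<open>F (p, v)\<close> squared.\<close>

lemma finsler_nonzero:
  assumes F: "finsler_metric F" and p: "p \<in> S2" and v: "v \<in> tangent_space p" "v \<noteq> 0"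
  shows "F (p, v) \<noteq> 0"
proof
  assume 0: "F (p, v) = 0"
  \<comment> \<open>The bounds keep \<open>1 + s + t\<close> positive, as homogeneity
    requires.\<close>
  have en: "energy F (p, v + s *\<^sub>R v + t *\<^sub>R v) = 0" if "\<bar>s\<bar> < 1 / 2" "\<bar>t\<bar> < 1 / 2" for s t
  proof -
    have "v + s *\<^sub>R v + t *\<^sub>R v = (1 + s + t) *\<^sub>R v" by (simp add: algebra_simps)
    then show ?thesis
      using finsler_scale[OF F p v(1), of "1 + s + t"] that 0 by (simp add: energy_def abs_if split: if_splits)
  qed
  have near: "\<forall>\<^sub>F t in nhds (0::real). \<bar>t\<bar> < 1 / 2"
    unfolding eventually_nhds_metric by (intro exI[of _ "1 / 2"]) (simp add: dist_norm)
  have inner: "deriv (\<lambda>t. energy F (p, v + s *\<^sub>R v + t *\<^sub>R v)) 0 = 0" if "\<bar>s\<bar> < 1 / 2" for s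
  proof -
    have "deriv (\<lambda>t. energy F (p, v + s *\<^sub>R v + t *\<^sub>R v)) 0 = deriv (\<lambda>t. 0) (0::real)"
      by (rule deriv_cong_ev) (use near in eventually_elim, auto intro: en that)
    then show ?thesis by simp
  qed
  have "fibre_hessian F p v v v = deriv (\<lambda>s. 0) (0::real)"
    unfolding fibre_hessian_def by (rule deriv_cong_ev) (use near in eventually_elim, auto intro: inner)
  moreover have "\<forall>(p, v)\<in>TS2. v \<noteq> 0 \<longrightarrow> (\<forall>w\<in>tangent_space p. w \<noteq> 0 \<longrightarrow> fibre_hessian F p v w w > 0)"
    using F unfolding finsler_metric_def by (elim conjE)
  from bspec[OF this, of "(p, v)"] have "fibre_hessian F p v v v > 0"
    using p v by (simp add: TS2_def)
  ultimately show False by simp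
qed

text \<open>One form \<open>q\<close> serves all points, and \<open>M\<close> carries the dependence
  on \<open>p\<close>. No regularity of \<open>M\<close> is claimed: smoothness of the metric will
  come from \<open>F\<close> itself.\<close>

lemma finsler_norms_isometric_to_form:
  assumes F: "finsler_metric F" and nabla: "linear_connection nabla" and comp: "compatible nabla F"
  obtains q where "\<And>p. p \<in> S2 \<Longrightarrow> \<exists>M. linear M \<and> (\<forall>v\<in>tangent_space p. (F (p, v))\<^sup>2 = qform q (M v))"
proof -
  obtain U where U: "continuous_on (sphere 0 1 \<times> UNIV) U" "\<And>z. norm z = 1 \<Longrightarrow> U (z, 0) = id_blinfun"
    "\<And>z t v. norm z = 1 \<Longrightarrow> merid z t \<bullet> blinfun_apply (U (z, t)) v = north \<bullet> v"
    "\<And>z t v. norm z = 1 \<Longrightarrow> t \<ge> 0 \<Longrightarrow> north \<bullet> v = 0 \<Longrightarrow>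
       F (merid z t, blinfun_apply (U (z, t)) v) = F (north, v)"
    using meridian_transport_exists[OF nabla comp] by blast
  have linU: "linear (blinfun_apply (U x))" for x
    by (rule bounded_linear.linear[OF blinfun.bounded_linear_right])
  have north: "north \<in> S2" using merid_S2[of 1 0] by (simp add: merid_def)
  have south: "- north \<in> S2" using merid_S2[of 1 pi] by (simp add: merid_def)
  have tan_north: "hor z \<in> tangent_space north" "hor z \<in> tangent_space (- north)" for z
    by (simp_all add: tangent_space_def)
  have hor_eq_0: "hor z = 0 \<longleftrightarrow> z = 0" for z
    using dehor_hor linear_0[OF linear_hor] linear_0[OF linear_dehor] by metis
  define f where "f z = (F (- north, hor z))\<^sup>2" for z
  \<comment> \<open>Transport from the north to the south pole at longitude \<open>\<phi>\<close>,
    read in the common horizontal plane.\<close>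
  define P where "P \<phi> z = dehor (blinfun_apply (U (cis \<phi>, pi)) (hor z))" for \<phi> z
  have linP: "linear (P \<phi>)" for \<phi>
    unfolding P_def using linear_compose[OF linear_compose[OF linear_hor linU] linear_dehor] by (simp add: o_def)
  have horP: "hor (P \<phi> z) = blinfun_apply (U (cis \<phi>, pi)) (hor z)" for \<phi> z
    unfolding P_def using U(3)[of "cis \<phi>" pi "hor z"] by (intro hor_dehor) (simp add: merid_def)
  have fP: "f (P \<phi> z) = (F (north, hor z))\<^sup>2" for \<phi> z
    using U(4)[of "cis \<phi>" pi "hor z"] by (simp add: f_def horP merid_def)
  have f_pos: "f z > 0" if "z \<noteq> 0" for z
    using finsler_nonzero[OF F south tan_north(2)[of z]] that by (simp add: f_def hor_eq_0)
  have f0: "f 0 = 0"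
    by (simp add: f_def linear_0[OF linear_hor] finsler_zero[OF F south])
  have P_eq_0: "P \<phi> z = 0 \<Longrightarrow> z = 0" for \<phi> z
    using fP[of \<phi> z] f0 finsler_nonzero[OF F north tan_north(1)[of z]] by (auto simp: hor_eq_0)
  have rays: "\<exists>\<phi> r. r > 0 \<and> w = r *\<^sub>R P \<phi> 1" if "w \<noteq> 0" for w
  proof -
    define V where "V = (\<lambda>(\<phi>, t). blinfun_apply (U (cis \<phi>, t)) (hor 1))"
    \<comment> \<open>The coordinates of the transported vector \<open>hor 1\<close> in the frame of
      \<open>mvel\<close> and the eastward vector. At \<open>t = 0\<close> this is
      \<open>cnj (cis \<phi>)\<close>; at \<open>t = pi\<close> the first frame vector has become
      \<open>- hor (cis \<phi>)\<close>, whence the conjugation in \<open>finish\<close>.\<close>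
    define g where "g = (\<lambda>(\<phi>, t). Complex (mvel (cis \<phi>) t \<bullet> V (\<phi>, t)) (hor (\<i> * cis \<phi>) \<bullet> V (\<phi>, t)))"
    have cU: "continuous_on A (\<lambda>x. U (cis (fst x), snd x))" for A :: "(real \<times> real) set"
      by (rule continuous_on_compose2[OF U(1)]) (auto intro!: continuous_intros continuous_on_cis)
    have cm: "continuous_on A (\<lambda>x. mvel (cis (fst x)) (snd x))" for A :: "(real \<times> real) set"
      unfolding mvel_def by (intro continuous_intros continuous_on_cis)
    have cont_g: "continuous_on ({0..2 * pi} \<times> {0..pi}) g"
      unfolding g_def V_def case_prod_unfold fst_conv snd_conv
      by (intro continuous_on_Complex continuous_on_inner cm continuous_on_hor continuous_intros cU continuous_on_cis)
    \<comment> \<open>The normal component is zero throughout, so a zero of \<open>g\<close> is a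
      zero of the transported vector, which preservation of \<open>F\<close> excludes.\<close>
    have nz: "g (\<phi>, t) \<noteq> 0" if "t \<in> {0..pi}" for \<phi> t
    proof
      assume "g (\<phi>, t) = 0"
      then have "V (\<phi>, t) = 0"
        using U(3)[of "cis \<phi>" t "hor 1"]
        by (intro merid_frame_eq_0[of "cis \<phi>" t]) (auto simp: g_def V_def complex_eq_iff)
      then have "F (north, hor 1) = 0"
        using U(4)[of "cis \<phi>" t "hor 1"] finsler_zero[OF F merid_S2] that by (simp add: V_def)
      then show False
        using finsler_nonzero[OF F north tan_north(1)[of 1]] by (simp add: hor_eq_0)
    qed
    have per: "g (2 * pi, t) = g (0, t)" for t
      by (simp add: g_def V_def)
    have start: "g (\<phi>, 0) = cis (- \<phi>)" for \<phi>
      by (simp add: g_def V_def U(2) mvel_def complex_eq_iff)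
    have finish: "g (\<phi>, pi) = - cnj (P \<phi> 1 * cis (- \<phi>))" for \<phi>
      by (simp add: g_def V_def horP[symmetric] mvel_def complex_eq_iff algebra_simps)
    show ?thesis
    proof (rule loop_meets_every_ray[of pi g "\<lambda>\<phi>. P \<phi> 1" w])
      show "\<exists>\<phi> r. r > 0 \<and> w = r *\<^sub>R P \<phi> 1" if "r > 0" "w = r *\<^sub>R P \<phi> 1" for \<phi> r
        using that by blast
    qed (use cont_g nz per start finish \<open>w \<noteq> 0\<close> in simp_all)
  qed
  have cont_f: "continuous_on UNIV f"
  proof -
    have "continuous_on TS2 F" using F by (simp add: finsler_metric_def)
    then have "continuous_on UNIV (\<lambda>z. F (- north, hor z))"
      by (rule continuous_on_compose2) (auto intro!: continuous_intros simp: TS2_def south tan_north)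
    then show ?thesis unfolding f_def by (intro continuous_intros)
  qed
  have hom_f: "f (r *\<^sub>R z) = r\<^sup>2 * f z" if "r > 0" for r z
    using finsler_scale[OF F south tan_north(2)[of z] that]
    by (simp add: f_def linear_scale[OF linear_hor] power_mult_distrib)
  have trans: "\<exists>A r. linear A \<and> f \<circ> A = f \<and> r > 0 \<and> w = r *\<^sub>R A (P 0 1)" if w: "w \<noteq> 0" for w
  proof -
    obtain \<phi> r where r: "r > 0" "w = r *\<^sub>R P \<phi> 1" using rays[OF w] by blast
    have "inj (P 0)"
      unfolding linear_injective_0[OF linP] using P_eq_0 by blast
    then obtain Q where Q: "linear Q" "\<And>z. Q (P 0 z) = z" "\<And>z. P 0 (Q z) = z"
      using linear_injective_isomorphism[OF linP] by metis
    have "f (P \<phi> (Q z)) = f z" for z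
      using fP[of \<phi> "Q z"] fP[of 0 "Q z"] Q(3) by simp
    then have "linear (P \<phi> \<circ> Q) \<and> f \<circ> (P \<phi> \<circ> Q) = f \<and> r > 0 \<and> w = r *\<^sub>R (P \<phi> \<circ> Q) (P 0 1)"
      using linear_compose[OF Q(1) linP] Q(2) r by auto
    then show ?thesis by blast
  qed
  have "P 0 1 \<noteq> 0" using P_eq_0[of 0 1] by auto
  then obtain q where q: "\<And>z. f z = qform q z"
    using quadratic_of_transitive[OF cont_f f_pos hom_f trans] by blast
  show ?thesis
  proof
    fix p assume "p \<in> S2"
    then obtain z t where zt: "norm z = 1" "t \<in> {0..pi}" "p = merid z t" by (rule S2_merid)
    let ?U = "blinfun_apply (U (z, t))"
    \<comment> \<open>A vector in the kernel is horizontal, since its normal component is conserved;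
      then preservation of \<open>F\<close> forces it to be zero.\<close>
    have "inj ?U"
      unfolding linear_injective_0[OF linU]
    proof (intro allI impI)
      fix v assume v: "?U v = 0"
      then have n: "north \<bullet> v = 0" using U(3)[OF zt(1), of t v] by simp
      then have "F (north, v) = 0"
        using U(4)[OF zt(1) _ n, of t] v zt(2) finsler_zero[OF F merid_S2[OF zt(1)]] by simp
      then show "v = 0"
        using finsler_nonzero[OF F north, of v] n by (auto simp: tangent_space_def)
    qed
    then obtain L where L: "linear L" "\<And>v. ?U (L v) = v"
      using linear_injective_isomorphism[OF linU] by metis
    \<comment> \<open>\<open>L\<close> transports back to the north pole, and \<open>P 0\<close>
      goes on to the south pole, where the norm is known to be quadratic.\<close>
    have "(F (p, v))\<^sup>2 = qform q ((P 0 \<circ> dehor \<circ> L) v)" if "v \<in> tangent_space p" for v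
    proof -
      have n: "north \<bullet> L v = 0"
        using U(3)[OF zt(1), of t "L v"] that zt(3) by (simp add: L(2) tangent_space_def)
      have "F (p, v) = F (north, L v)"
        using U(4)[OF zt(1) _ n, of t] zt by (simp add: L(2))
      also have "L v = hor (dehor (L v))" using hor_dehor[OF n] by simp
      finally show ?thesis using fP[of 0 "dehor (L v)"] by (simp add: q)
    qed
    then show "\<exists>M. linear M \<and> (\<forall>v\<in>tangent_space p. (F (p, v))\<^sup>2 = qform q (M v))"
      using linear_compose[OF L(1) linear_compose[OF linear_dehor linP[of 0]]] by (auto simp: o_assoc)
  qed
qed

section \<open>Polarization and smoothness of the metric\<close>

definition qbil :: "real \<times> real \<times> real \<Rightarrow> complex \<Rightarrow> complex \<Rightarrow> real" where
  "qbil q z w = fst q * Re z * Re w + fst (snd q) * (Re z * Im w + Im z * Re w) + snd (snd q) * Im z * Im w"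

lemma qform_add: "qform q (z + w) = qform q z + qform q w + 2 * qbil q z w"
  by (simp add: qform_def qbil_def power2_eq_square algebra_simps)

lemma qbil_linear: "qbil q (a *\<^sub>R z + b *\<^sub>R z') w = a * qbil q z w + b * qbil q z' w"
  by (simp add: qbil_def algebra_simps)

lemma smooth_on_finsler:
  assumes F: "finsler_metric F" and K: "vector_field K" and "A \<subseteq> S2" "\<And>p. p \<in> A \<Longrightarrow> K p \<noteq> 0"
  shows "smooth_on A (\<lambda>p. (F (p, K p))\<^sup>2)"
proof -
  have "smooth_on A (\<lambda>p. (p, K p))"
    using K assms(3) by (intro smooth_on_Pair smooth_on_id) (auto simp: vector_field_def intro: smooth_on_subset)
  moreover have "smooth_on {(p, v) \<in> TS2. v \<noteq> 0} F"
    using F by (simp add: finsler_metric_def)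
  ultimately have "smooth_on A (\<lambda>p. F (p, K p))"
    by (rule smooth_on_compose) (use K assms(3,4) in \<open>auto simp: TS2_def vector_field_def\<close>)
  then show ?thesis
    unfolding power2_eq_square by (intro smooth_on_mult)
qed

text \<open>The multiples of the unit vector \<open>mvel z t\<close> are an infinite set of tangent
  vectors.\<close>

lemma tangent_avoids_finite:
  assumes "p \<in> S2" "finite B"
  obtains a where "a \<in> tangent_space p" "a \<notin> B"
proof -
  obtain z t where zt: "norm z = 1" "p = merid z t" using S2_merid[OF assms(1)] by metis
  let ?e = "mvel z t"
  have "?e \<noteq> 0" using merid_inner(3)[OF zt(1), of t] by auto
  then have "inj (\<lambda>r. r *\<^sub>R ?e)" by (simp add: inj_on_def)
  then have "infinite (range (\<lambda>r. r *\<^sub>R ?e))"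
    using finite_imageD infinite_UNIV_char_0 by blast
  then obtain r where "r *\<^sub>R ?e \<notin> B"
    using assms(2) finite_subset by (metis (no_types, lifting) image_subset_iff rangeE subsetI)
  moreover have "r *\<^sub>R ?e \<in> tangent_space p"
    using merid_inner(2)[OF zt(1)] zt(2) by (simp add: tangent_space_def)
  ultimately show ?thesis using that by blast
qed

lemma is_riemannian_of_forms:
  assumes F: "finsler_metric F"
    and M: "\<And>p. p \<in> S2 \<Longrightarrow> \<exists>M. linear M \<and> (\<forall>v\<in>tangent_space p. (F (p, v))\<^sup>2 = qform q (M v))"
  shows "is_riemannian F"
proof -
  \<comment> \<open>Polarization in terms of \<open>F\<close> alone, so that smoothness can be
    inherited from \<open>F\<close>; the maps \<open>M\<close> enter only in the pointwise
    algebra.\<close>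
  define \<gamma> where "\<gamma> p u v = ((F (p, u + v))\<^sup>2 - (F (p, u))\<^sup>2 - (F (p, v))\<^sup>2) / 2" for p u v
  have tan_add: "u + v \<in> tangent_space p" if "u \<in> tangent_space p" "v \<in> tangent_space p" for p u v
    using that by (simp add: tangent_space_def inner_add_right)
  have tan_scale: "r *\<^sub>R u \<in> tangent_space p" if "u \<in> tangent_space p" for p u r
    using that by (simp add: tangent_space_def)
  have bil: "\<exists>M. linear M \<and> (\<forall>v\<in>tangent_space p. (F (p, v))\<^sup>2 = qform q (M v)) \<and>
      (\<forall>u\<in>tangent_space p. \<forall>v\<in>tangent_space p. \<gamma> p u v = qbil q (M u) (M v))" if "p \<in> S2" for p
  proof -
    obtain M where M: "linear M" "\<forall>v\<in>tangent_space p. (F (p, v))\<^sup>2 = qform q (M v)"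
      using assms(2)[OF \<open>p \<in> S2\<close>] by blast
    then have "\<gamma> p u v = qbil q (M u) (M v)" if "u \<in> tangent_space p" "v \<in> tangent_space p" for u v
      using that tan_add[OF that] by (simp add: \<gamma>_def linear_add[OF M(1)] qform_add)
    with M show ?thesis by blast
  qed
  have diag: "(F (p, v))\<^sup>2 = \<gamma> p v v" if "p \<in> S2" "v \<in> tangent_space p" for p v
  proof -
    obtain M where M: "linear M" "\<forall>v\<in>tangent_space p. (F (p, v))\<^sup>2 = qform q (M v)"
      "\<forall>u\<in>tangent_space p. \<forall>v\<in>tangent_space p. \<gamma> p u v = qbil q (M u) (M v)"
      using bil[OF \<open>p \<in> S2\<close>] by blast
    then show ?thesis
      using that by (simp add: qform_def qbil_def power2_eq_square)
  qed
  \<comment> \<open>\<open>F\<^sup>2\<close> is smooth only off the zero section. Near a point, shift both fields by a field \<open>W\<close> for which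
    \<open>W\<close>, \<open>X + W\<close>, \<open>Y + W\<close> and \<open>X + Y + W\<close> do not vanish; the second difference recovers \<open>\<gamma>\<close>.\<close>
  have smooth: "smooth_on S2 (\<lambda>p. \<gamma> p (X p) (Y p))" if X: "vector_field X" and Y: "vector_field Y" for X Y
  proof (rule smooth_on_local)
    fix p0 assume p0: "p0 \<in> S2"
    \<comment> \<open>Each excluded value would make one of the four shifted fields vanish at
      \<open>p0\<close>.\<close>
    obtain a where a: "a \<in> tangent_space p0" "a \<notin> {0, - X p0, - Y p0, - (X p0 + Y p0)}"
      using tangent_avoids_finite[OF p0, of "{0, - X p0, - Y p0, - (X p0 + Y p0)}"] by auto
    define W where "W p = tproj p a" for p
    have W: "vector_field W" "W p0 = a"
      using vector_field_tproj[of a] a(1) by (simp_all add: W_def[abs_def] tproj_eq)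
    let ?XYW = "\<lambda>p. X p + Y p + W p" and ?XW = "\<lambda>p. X p + W p" and ?YW = "\<lambda>p. Y p + W p"
    have vf: "vector_field ?XYW" "vector_field ?XW" "vector_field ?YW"
      by (intro vector_field_add X Y W)+
    have ne: "?XYW p0 \<noteq> 0" "?XW p0 \<noteq> 0" "?YW p0 \<noteq> 0" "W p0 \<noteq> 0"
      using a(2) by (auto simp: W(2) eq_neg_iff_add_eq_0 algebra_simps)
    \<comment> \<open>The product of the four norms: its nonvanishing set gives a common
      neighbourhood on which none of the fields vanishes.\<close>
    define h where "h p = norm (?XYW p) * norm (?XW p) * (norm (?YW p) * norm (W p))" for p
    have "continuous_on S2 h"
      unfolding h_def using vf W(1)
      by (intro continuous_on_mult continuous_on_norm smooth_on_imp_continuous_on) (auto simp: vector_field_def)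
    then obtain T where T: "open T" "T \<inter> S2 = h -` (- {0}) \<inter> S2"
      using continuous_on_open_invariant[of S2 h] open_Compl[OF closed_singleton] by blast
    have "p0 \<in> T" using T(2) p0 ne by (auto simp: h_def)
    have nz: "?XYW p \<noteq> 0" "?XW p \<noteq> 0" "?YW p \<noteq> 0" "W p \<noteq> 0" if "p \<in> S2 \<inter> T" for p
    proof -
      have "h p \<noteq> 0" using that T(2) by auto
      then show "?XYW p \<noteq> 0" "?XW p \<noteq> 0" "?YW p \<noteq> 0" "W p \<noteq> 0" by (auto simp: h_def)
    qed
    have eq: "\<gamma> p (X p) (Y p) = (1 / 2) * ((F (p, ?XYW p))\<^sup>2 - (F (p, ?XW p))\<^sup>2 - (F (p, ?YW p))\<^sup>2 + (F (p, W p))\<^sup>2)"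
      if "p \<in> S2 \<inter> T" for p
    proof -
      have p: "p \<in> S2" using that by simp
      obtain M where M: "linear M" "\<forall>v\<in>tangent_space p. (F (p, v))\<^sup>2 = qform q (M v)"
        "\<forall>u\<in>tangent_space p. \<forall>v\<in>tangent_space p. \<gamma> p u v = qbil q (M u) (M v)"
        using bil[OF p] by blast
      have t: "X p \<in> tangent_space p" "Y p \<in> tangent_space p" "W p \<in> tangent_space p"
        using X Y W(1) p by (auto simp: vector_field_def)
      show ?thesis
        using M(2,3) t tan_add t[THEN tan_add] by (simp add: linear_add[OF M(1)])
          (simp add: qform_def qbil_def power2_eq_square algebra_simps)
    qed
    have "smooth_on (S2 \<inter> T) (\<lambda>p. (1 / 2) * ((F (p, ?XYW p))\<^sup>2 - (F (p, ?XW p))\<^sup>2 - (F (p, ?YW p))\<^sup>2 + (F (p, W p))\<^sup>2))"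
      by (intro smooth_on_mult smooth_on_const smooth_on_add smooth_on_diff
          smooth_on_finsler[OF F vf(1) Int_lower1] smooth_on_finsler[OF F vf(2) Int_lower1]
          smooth_on_finsler[OF F vf(3) Int_lower1] smooth_on_finsler[OF F W(1) Int_lower1] nz)
    then have "smooth_on (S2 \<inter> T) (\<lambda>p. \<gamma> p (X p) (Y p))"
      by (rule smooth_on_cong[rotated]) (simp only: eq)
    then show "\<exists>T. open T \<and> p0 \<in> T \<and> smooth_on (S2 \<inter> T) (\<lambda>p. \<gamma> p (X p) (Y p))"
      using T(1) \<open>p0 \<in> T\<close> by blast
  qed
  have "riemannian_metric \<gamma>"
    unfolding riemannian_metric_def
  proof (intro conjI ballI allI impI)
    fix p u v w a b
    assume p: "p \<in> S2" and t: "u \<in> tangent_space p" "v \<in> tangent_space p" "w \<in> tangent_space p"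
    obtain M where M: "linear M" "\<forall>u\<in>tangent_space p. \<forall>v\<in>tangent_space p. \<gamma> p u v = qbil q (M u) (M v)"
      using bil[OF p] by blast
    have "a *\<^sub>R u + b *\<^sub>R v \<in> tangent_space p" using t by (intro tan_add tan_scale)
    then show "\<gamma> p (a *\<^sub>R u + b *\<^sub>R v) w = a * \<gamma> p u w + b * \<gamma> p v w"
      using M t by (simp add: linear_add linear_scale qbil_linear)
  next
    show "\<gamma> p u v = \<gamma> p v u" for p u v by (simp add: \<gamma>_def add.commute)
  next
    show "\<gamma> p v v > 0" if "p \<in> S2" "v \<in> tangent_space p" "v \<noteq> 0" for p v
      using diag[OF that(1,2)] finsler_nonzero[OF F that] by (metis zero_less_power2)
  qed (rule smooth)
  then show ?thesis
    unfolding is_riemannian_def using diag by (auto simp: TS2_def)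
qed

theorem corollary3:
  shows "\<not> (\<exists>F :: (real^3) \<times> (real^3) \<Rightarrow> real. finsler_metric F \<and> \<not> is_riemannian F \<and>
            (\<exists>nabla. linear_connection nabla \<and> compatible nabla F))"
  using finsler_norms_isometric_to_form is_riemannian_of_forms by metis

end
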